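(* Let $M$ be a finite inverse monoid and $k$ an algebraically closed field of any characteristic. Then $kM$ satisfies the group-injective condition: there is a projective indecomposable $kG$-module $P$, where $G$ is the group of units of $M$, such that $\mathrm{Ind}(P)$ is injective as a $kM$-module.
   Context: For a $kG$-module $W$, $\mathrm{Ind}(W)$ is the $kM$-module with underlying space $W$ on which $G$ acts as given and all elements of $M\setminus G$ act as $0$. Modules are unital finite-dimensional left modules. *)

theory Defs
  imports "HOL-Algebra.Algebra"
begin

locale inverse_monoid = monoid M for M (structure) +
  assumes ex1_inverse:
    "x \<in> carrier M \<Longrightarrow> \<exists>!y. y \<in> carrier M \<and> x \<otimes> y \<otimes> x = x \<and> y \<otimes> x \<otimes> y = y"

(* The algebra kM of a finite monoid M: k-valued functions on M under convolution. It is
   only meant for finite M (no finite-support condition is imposed). *)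
definition monoid_algebra ::
    "('k, 'c) ring_scheme \<Rightarrow> ('m, 'd) monoid_scheme \<Rightarrow> ('m \<Rightarrow> 'k) ring" where
  "monoid_algebra k M =
     \<lparr>carrier = carrier M \<rightarrow>\<^sub>E carrier k,
      monoid.mult = (\<lambda>a b. \<lambda>m\<in>carrier M.
        \<Oplus>\<^bsub>k\<^esub>p\<in>{p \<in> carrier M \<times> carrier M. fst p \<otimes>\<^bsub>M\<^esub> snd p = m}. a (fst p) \<otimes>\<^bsub>k\<^esub> b (snd p)),
      monoid.one = (\<lambda>m\<in>carrier M. if m = \<one>\<^bsub>M\<^esub> then \<one>\<^bsub>k\<^esub> else \<zero>\<^bsub>k\<^esub>),
      ring.zero = (\<lambda>m\<in>carrier M. \<zero>\<^bsub>k\<^esub>),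
      ring.add = (\<lambda>a b. \<lambda>m\<in>carrier M. a m \<oplus>\<^bsub>k\<^esub> b m)\<rparr>"

definition basis_elem ::
    "('k, 'c) ring_scheme \<Rightarrow> ('m, 'd) monoid_scheme \<Rightarrow> 'm \<Rightarrow> 'm \<Rightarrow> 'k" where
  "basis_elem k M x = (\<lambda>m\<in>carrier M. if m = x then \<one>\<^bsub>k\<^esub> else \<zero>\<^bsub>k\<^esub>)"

(* c * 1, the image of c under the structure map k -> kM; it gives a kM-module its
   k-vector space structure. *)
definition scalar_elem ::
    "('k, 'c) ring_scheme \<Rightarrow> ('m, 'd) monoid_scheme \<Rightarrow> 'k \<Rightarrow> 'm \<Rightarrow> 'k" where
  "scalar_elem k M c = (\<lambda>m\<in>carrier M. if m = \<one>\<^bsub>M\<^esub> then c else \<zero>\<^bsub>k\<^esub>)"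

(* The axioms of the library locale module, over a ring that need not be commutative.
   The fields mult and one of the module record carry no meaning. *)
locale left_module = R?: ring R + V?: abelian_group V
    for R :: "('r, 'c) ring_scheme" (structure) and V :: "('r, 'v, 'e) module_scheme" (structure) +
  assumes smult_closed:
      "\<lbrakk>a \<in> carrier R; x \<in> carrier V\<rbrakk> \<Longrightarrow> a \<odot>\<^bsub>V\<^esub> x \<in> carrier V"
    and smult_l_distr:
      "\<lbrakk>a \<in> carrier R; b \<in> carrier R; x \<in> carrier V\<rbrakk> \<Longrightarrow>
       (a \<oplus>\<^bsub>R\<^esub> b) \<odot>\<^bsub>V\<^esub> x = a \<odot>\<^bsub>V\<^esub> x \<oplus>\<^bsub>V\<^esub> b \<odot>\<^bsub>V\<^esub> x"
    and smult_r_distr: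
      "\<lbrakk>a \<in> carrier R; x \<in> carrier V; y \<in> carrier V\<rbrakk> \<Longrightarrow>
       a \<odot>\<^bsub>V\<^esub> (x \<oplus>\<^bsub>V\<^esub> y) = a \<odot>\<^bsub>V\<^esub> x \<oplus>\<^bsub>V\<^esub> a \<odot>\<^bsub>V\<^esub> y"
    and smult_assoc:
      "\<lbrakk>a \<in> carrier R; b \<in> carrier R; x \<in> carrier V\<rbrakk> \<Longrightarrow>
       (a \<otimes>\<^bsub>R\<^esub> b) \<odot>\<^bsub>V\<^esub> x = a \<odot>\<^bsub>V\<^esub> (b \<odot>\<^bsub>V\<^esub> x)"
    and smult_one:
      "x \<in> carrier V \<Longrightarrow> \<one>\<^bsub>R\<^esub> \<odot>\<^bsub>V\<^esub> x = x"

definition fd_module ::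
    "('k, 'c) ring_scheme \<Rightarrow> ('m, 'd) monoid_scheme \<Rightarrow> ('m \<Rightarrow> 'k, 'v, 'e) module_scheme \<Rightarrow> bool"
  where
  "fd_module k M V \<longleftrightarrow> left_module (monoid_algebra k M) V \<and>
     (\<exists>B. finite B \<and> B \<subseteq> carrier V \<and>
        (\<forall>v\<in>carrier V. \<exists>c\<in>B \<rightarrow> carrier k. v = (\<Oplus>\<^bsub>V\<^esub>b\<in>B. scalar_elem k M (c b) \<odot>\<^bsub>V\<^esub> b)))"

definition left_module_hom ::
    "('r, 'c) ring_scheme \<Rightarrow> ('r, 'v, 'd) module_scheme \<Rightarrow> ('r, 'w, 'e) module_scheme
      \<Rightarrow> ('v \<Rightarrow> 'w) set" where
  "left_module_hom R V W = {f \<in> carrier V \<rightarrow> carrier W.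
     (\<forall>x\<in>carrier V. \<forall>y\<in>carrier V. f (x \<oplus>\<^bsub>V\<^esub> y) = f x \<oplus>\<^bsub>W\<^esub> f y) \<and>
     (\<forall>a\<in>carrier R. \<forall>x\<in>carrier V. f (a \<odot>\<^bsub>V\<^esub> x) = a \<odot>\<^bsub>W\<^esub> f x)}"

definition indecomposable_module ::
    "('r, 'c) ring_scheme \<Rightarrow> ('r, 'v, 'd) module_scheme \<Rightarrow> bool" where
  "indecomposable_module R V \<longleftrightarrow> carrier V \<noteq> {\<zero>\<^bsub>V\<^esub>} \<and>
     (\<forall>U W. submodule U R V \<and> submodule W R V \<and> U <+>\<^bsub>V\<^esub> W = carrier V \<and> U \<inter> W = {\<zero>\<^bsub>V\<^esub>}
        \<longrightarrow> U = {\<zero>\<^bsub>V\<^esub>} \<or> W = {\<zero>\<^bsub>V\<^esub>})"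

(* Injectivity and projectivity in the category of finite-dimensional modules. The test
   modules have carriers in nat => 'k; this loses nothing, since every finite-dimensional
   module has an isomorphic copy there (fd_module_copy). The lemmas injective_module_extend
   and projective_module_lift give the properties for test modules over arbitrary types. *)
definition injective_module ::
    "('k, 'c) ring_scheme \<Rightarrow> ('m, 'd) monoid_scheme \<Rightarrow> ('m \<Rightarrow> 'k, 'v, 'e) module_scheme \<Rightarrow> bool"
  where
  "injective_module k M V \<longleftrightarrow> fd_module k M V \<and>
     (\<forall>(A :: ('m \<Rightarrow> 'k, nat \<Rightarrow> 'k) module) (B :: ('m \<Rightarrow> 'k, nat \<Rightarrow> 'k) module).
        fd_module k M A \<and> fd_module k M B \<longrightarrow>
        (\<forall>f \<in> left_module_hom (monoid_algebra k M) A B.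
         \<forall>g \<in> left_module_hom (monoid_algebra k M) A V.
           inj_on f (carrier A) \<longrightarrow>
           (\<exists>h \<in> left_module_hom (monoid_algebra k M) B V. \<forall>x\<in>carrier A. h (f x) = g x)))"

definition projective_module ::
    "('k, 'c) ring_scheme \<Rightarrow> ('m, 'd) monoid_scheme \<Rightarrow> ('m \<Rightarrow> 'k, 'v, 'e) module_scheme \<Rightarrow> bool"
  where
  "projective_module k M V \<longleftrightarrow> fd_module k M V \<and>
     (\<forall>(A :: ('m \<Rightarrow> 'k, nat \<Rightarrow> 'k) module) (B :: ('m \<Rightarrow> 'k, nat \<Rightarrow> 'k) module).
        fd_module k M A \<and> fd_module k M B \<longrightarrow>
        (\<forall>f \<in> left_module_hom (monoid_algebra k M) A B.
         \<forall>g \<in> left_module_hom (monoid_algebra k M) V B.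
           f ` carrier A = carrier B \<longrightarrow>
           (\<exists>h \<in> left_module_hom (monoid_algebra k M) V A. \<forall>x\<in>carrier V. f (h x) = g x)))"

(* By linearity, letting every element of M outside its group of units G act as 0 means
   that an element of kM acts through its restriction to G, which lies in kG; see
   ind_module_unit and ind_module_nonunit. *)
definition ind_module ::
    "('m, 'd) monoid_scheme \<Rightarrow> ('m \<Rightarrow> 'k, 'v, 'e) module_scheme \<Rightarrow> ('m \<Rightarrow> 'k, 'v, 'e) module_scheme"
  where
  "ind_module M W = W\<lparr>smult := (\<lambda>a w. restrict a (Units M) \<odot>\<^bsub>W\<^esub> w)\<rparr>"

definition group_injective ::
    "('k, 'c) ring_scheme \<Rightarrow> ('m, 'd) monoid_scheme \<Rightarrow> bool" where
  "group_injective k M \<longleftrightarrow>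
     (\<exists>P :: ('m \<Rightarrow> 'k, nat \<Rightarrow> 'k) module.
        projective_module k (units_of M) P \<and>
        indecomposable_module (monoid_algebra k (units_of M)) P \<and>
        injective_module k M (ind_module M P))"

lemma ind_module_unit:
  assumes "u \<in> Units M"
  shows "basis_elem k M u \<odot>\<^bsub>ind_module M W\<^esub> w = basis_elem k (units_of M) u \<odot>\<^bsub>W\<^esub> w"
proof -
  have "Units M \<subseteq> carrier M" by (auto simp: Units_def)
  then have "restrict (basis_elem k M u) (Units M) = basis_elem k (units_of M) u"
    by (auto simp: basis_elem_def units_of_def restrict_def fun_eq_iff)
  then show ?thesis by (simp add: ind_module_def)
qed

lemma (in left_module) smult_l_null:
  assumes "x \<in> carrier V" shows "\<zero>\<^bsub>R\<^esub> \<odot>\<^bsub>V\<^esub> x = \<zero>\<^bsub>V\<^esub>"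
proof -
  have "\<zero>\<^bsub>R\<^esub> \<odot>\<^bsub>V\<^esub> x = \<zero>\<^bsub>R\<^esub> \<odot>\<^bsub>V\<^esub> x \<oplus>\<^bsub>V\<^esub> \<zero>\<^bsub>R\<^esub> \<odot>\<^bsub>V\<^esub> x"
    using smult_l_distr[of "\<zero>\<^bsub>R\<^esub>" "\<zero>\<^bsub>R\<^esub>" x] assms by simp
  then show ?thesis
    using smult_closed[OF R.zero_closed assms] by (metis V.add.r_cancel_one')
qed

lemma ind_module_nonunit:
  assumes "left_module (monoid_algebra k (units_of M)) W"
    and "m \<in> carrier M" "m \<notin> Units M" "w \<in> carrier W"
  shows "basis_elem k M m \<odot>\<^bsub>ind_module M W\<^esub> w = \<zero>\<^bsub>W\<^esub>"
proof -
  have "Units M \<subseteq> carrier M" by (auto simp: Units_def)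
  then have "restrict (basis_elem k M m) (Units M) = \<zero>\<^bsub>monoid_algebra k (units_of M)\<^esub>"
    using assms(3)
    by (auto simp: basis_elem_def units_of_def restrict_def fun_eq_iff monoid_algebra_def)
  then show ?thesis
    using left_module.smult_l_null[OF assms(1,4)] by (simp add: ind_module_def)
qed

lemma transport_module:
  fixes V :: "('r, 'v, 'e) module_scheme" and \<phi> :: "'v \<Rightarrow> 'w"
  assumes V: "left_module R V" and inj: "inj_on \<phi> (carrier V)"
  obtains W :: "('r, 'w) module"
  where "left_module R W" "\<phi> \<in> left_module_hom R V W" "\<phi> ` carrier V = carrier W"
    "inv_into (carrier V) \<phi> \<in> left_module_hom R W V"
proof -
  interpret left_module R V by (rule V)
  define \<psi> where "\<psi> = inv_into (carrier V) \<phi>"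
  define W :: "('r, 'w) module" where
    "W = \<lparr>carrier = \<phi> ` carrier V, monoid.mult = undefined, monoid.one = undefined,
          ring.zero = \<phi> \<zero>\<^bsub>V\<^esub>,
          ring.add = (\<lambda>x y. \<phi> (\<psi> x \<oplus>\<^bsub>V\<^esub> \<psi> y)), smult = (\<lambda>a x. \<phi> (a \<odot>\<^bsub>V\<^esub> \<psi> x))\<rparr>"
  have \<psi>: "\<psi> (\<phi> x) = x" if "x \<in> carrier V" for x
    using that inj by (simp add: \<psi>_def)
  have W: "abelian_group W"
  proof (rule abelian_groupI)
    fix x assume "x \<in> carrier W"
    then obtain v where v: "v \<in> carrier V" "x = \<phi> v" by (auto simp: W_def)
    then show "\<exists>y\<in>carrier W. y \<oplus>\<^bsub>W\<^esub> x = \<zero>\<^bsub>W\<^esub>"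
      by (intro bexI[of _ "\<phi> (\<ominus>\<^bsub>V\<^esub> v)"]) (auto simp: W_def \<psi> V.l_neg)
  qed (auto simp: W_def \<psi> V.a_ac)
  show ?thesis
  proof (rule that[of W])
    show "left_module R W"
      by (intro left_module.intro left_module_axioms.intro W R.ring_axioms)
        (auto simp: W_def \<psi> smult_closed smult_l_distr smult_r_distr smult_assoc smult_one)
    show "\<phi> \<in> left_module_hom R V W"
      by (auto simp: left_module_hom_def W_def \<psi>)
    show "inv_into (carrier V) \<phi> \<in> left_module_hom R W V"
      unfolding \<psi>_def[symmetric] by (auto simp: left_module_hom_def W_def \<psi> smult_closed)
  qed (simp add: W_def)
qed

lemma left_module_hom_zero:
  assumes "left_module R V" "left_module R W" "f \<in> left_module_hom R V W"
  shows "f \<zero>\<^bsub>V\<^esub> = \<zero>\<^bsub>W\<^esub>"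
proof -
  interpret V: left_module R V by fact
  interpret W: left_module R W by fact
  have "f \<zero>\<^bsub>V\<^esub> \<in> carrier W" "f (\<zero>\<^bsub>V\<^esub> \<oplus>\<^bsub>V\<^esub> \<zero>\<^bsub>V\<^esub>) = f \<zero>\<^bsub>V\<^esub> \<oplus>\<^bsub>W\<^esub> f \<zero>\<^bsub>V\<^esub>"
    using assms(3) V.V.zero_closed by (auto simp: left_module_hom_def simp del: V.V.r_zero V.V.l_zero)
  then show ?thesis by (metis W.V.add.r_cancel_one' V.V.r_zero V.V.zero_closed)
qed

lemma left_module_hom_finsum:
  assumes "left_module R V" "left_module R W" "f \<in> left_module_hom R V W"
    and "finite S" "\<And>s. s \<in> S \<Longrightarrow> t s \<in> carrier V"
  shows "f (\<Oplus>\<^bsub>V\<^esub>s\<in>S. t s) = (\<Oplus>\<^bsub>W\<^esub>s\<in>S. f (t s))"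
proof -
  interpret V: left_module R V by fact
  interpret W: left_module R W by fact
  show ?thesis
    using assms(4,5)
  proof (induction S rule: finite_induct)
    case empty
    then show ?case using left_module_hom_zero[OF assms(1-3)] by simp
  next
    case (insert s S)
    have "t \<in> S \<rightarrow> carrier V" "(\<lambda>s. f (t s)) \<in> S \<rightarrow> carrier W" "f (t s) \<in> carrier W"
      using insert assms(3) by (auto simp: left_module_hom_def)
    with insert show ?case
      using assms(3) by (simp add: left_module_hom_def)
  qed
qed

lemma left_module_hom_comp:
  assumes "f \<in> left_module_hom R U V" "g \<in> left_module_hom R V W"
  shows "(\<lambda>x. g (f x)) \<in> left_module_hom R U W"
  using assms by (auto simp: left_module_hom_def Pi_iff)

lemma scalar_elem_closed:
  "\<lbrakk>ring k; c \<in> carrier k\<rbrakk> \<Longrightarrow> scalar_elem k M c \<in> carrier (monoid_algebra k M)"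
  by (auto simp: scalar_elem_def monoid_algebra_def ring.ring_simprules)

lemma fd_module_image:
  assumes "ring k" "fd_module k M V" "left_module (monoid_algebra k M) W"
    and f: "f \<in> left_module_hom (monoid_algebra k M) V W" "f ` carrier V = carrier W"
    and inj: "inj_on f (carrier V)"
  shows "fd_module k M W"
proof -
  have V: "left_module (monoid_algebra k M) V" using assms(2) by (simp add: fd_module_def)
  interpret V: left_module "monoid_algebra k M" V by (rule V)
  interpret W: left_module "monoid_algebra k M" W by fact
  obtain B where B: "finite B" "B \<subseteq> carrier V"
    and span: "\<forall>v\<in>carrier V. \<exists>c\<in>B \<rightarrow> carrier k.
      v = (\<Oplus>\<^bsub>V\<^esub>b\<in>B. scalar_elem k M (c b) \<odot>\<^bsub>V\<^esub> b)"
    using assms(2) unfolding fd_module_def by (elim conjE exE) (rule that)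
  have "\<exists>c\<in>f ` B \<rightarrow> carrier k. w = (\<Oplus>\<^bsub>W\<^esub>b\<in>f ` B. scalar_elem k M (c b) \<odot>\<^bsub>W\<^esub> b)"
    if w: "w \<in> carrier W" for w
  proof -
    obtain v where v: "v \<in> carrier V" "w = f v" using w f(2) by blast
    obtain c where c: "c \<in> B \<rightarrow> carrier k" "v = (\<Oplus>\<^bsub>V\<^esub>b\<in>B. scalar_elem k M (c b) \<odot>\<^bsub>V\<^esub> b)"
      using span v(1) by blast
    have sc: "scalar_elem k M (c b) \<in> carrier (monoid_algebra k M)" if "b \<in> B" for b
      using that c(1) scalar_elem_closed[OF assms(1), of _ M] by blast
    have injB: "inj_on f B" using inj B(2) by (rule inj_on_subset)
    define d where "d = c \<circ> inv_into B f"
    have d: "d (f b) = c b" if "b \<in> B" for b using that injB by (simp add: d_def)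
    have fW: "f b \<in> carrier W" if "b \<in> B" for b using that B(2) f(2) by blast
    have "w = (\<Oplus>\<^bsub>W\<^esub>b\<in>B. f (scalar_elem k M (c b) \<odot>\<^bsub>V\<^esub> b))"
      unfolding v(2) c(2) using B sc
      by (intro left_module_hom_finsum[OF V assms(3) f(1)]) (auto intro!: V.smult_closed)
    also have "\<dots> = (\<Oplus>\<^bsub>W\<^esub>b\<in>B. scalar_elem k M (d (f b)) \<odot>\<^bsub>W\<^esub> f b)"
      using B(2) f(1) sc fW
      by (intro W.V.finsum_cong') (auto simp: left_module_hom_def d intro!: W.smult_closed)
    also have "\<dots> = (\<Oplus>\<^bsub>W\<^esub>b\<in>f ` B. scalar_elem k M (d b) \<odot>\<^bsub>W\<^esub> b)"
      using injB sc fW by (intro W.V.finsum_reindex[symmetric]) (auto simp: d intro!: W.smult_closed)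
    finally have "w = (\<Oplus>\<^bsub>W\<^esub>b\<in>f ` B. scalar_elem k M (d b) \<odot>\<^bsub>W\<^esub> b)" .
    moreover have "d \<in> f ` B \<rightarrow> carrier k" using c(1) by (auto simp: d)
    ultimately show ?thesis by blast
  qed
  moreover have "finite (f ` B)" "f ` B \<subseteq> carrier W" using B f(2) by auto
  ultimately show ?thesis using assms(3) unfolding fd_module_def by blast
qed

lemma fd_module_copy:
  fixes V :: "('m \<Rightarrow> 'k, 'v, 'e) module_scheme"
  assumes k: "ring k" and V: "fd_module k M V"
  obtains W :: "('m \<Rightarrow> 'k, nat \<Rightarrow> 'k) module" and \<phi>
  where "fd_module k M W" "\<phi> \<in> left_module_hom (monoid_algebra k M) V W"
    "bij_betw \<phi> (carrier V) (carrier W)"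
    "inv_into (carrier V) \<phi> \<in> left_module_hom (monoid_algebra k M) W V"
proof -
  have LV: "left_module (monoid_algebra k M) V" using V by (simp add: fd_module_def)
  obtain B where B: "finite B" "B \<subseteq> carrier V"
    and span: "\<forall>v\<in>carrier V. \<exists>c\<in>B \<rightarrow> carrier k.
      v = (\<Oplus>\<^bsub>V\<^esub>b\<in>B. scalar_elem k M (c b) \<odot>\<^bsub>V\<^esub> b)"
    using V unfolding fd_module_def by (elim conjE exE) (rule that)
  interpret left_module "monoid_algebra k M" V by (rule LV)
  obtain c where c0: "\<forall>v\<in>carrier V. c v \<in> B \<rightarrow> carrier k \<and>
      v = (\<Oplus>\<^bsub>V\<^esub>b\<in>B. scalar_elem k M (c v b) \<odot>\<^bsub>V\<^esub> b)"
    using bchoice[OF span[unfolded Bex_def]] by (elim exE) (rule that)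
  have c: "c v \<in> B \<rightarrow> carrier k"
    "v = (\<Oplus>\<^bsub>V\<^esub>b\<in>B. scalar_elem k M (c v b) \<odot>\<^bsub>V\<^esub> b)" if "v \<in> carrier V" for v
    by (rule conjunct1[OF bspec[OF c0 that]], rule conjunct2[OF bspec[OF c0 that]])
  obtain e :: "nat \<Rightarrow> 'v" and n where e: "B = e ` {i. i < n}"
    using finite_imp_nat_seg_image_inj_on[OF B(1)] by (elim exE conjE) (rule that)
  define \<phi> where "\<phi> = (\<lambda>v i. c v (e i))"
  have inj: "inj_on \<phi> (carrier V)"
  proof (rule inj_onI)
    fix x y assume xy: "x \<in> carrier V" "y \<in> carrier V" "\<phi> x = \<phi> y"
    then have "c x b = c y b" if "b \<in> B" for b
      using that e by (auto simp: \<phi>_def dest: fun_cong)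
    then have "(\<Oplus>\<^bsub>V\<^esub>b\<in>B. scalar_elem k M (c x b) \<odot>\<^bsub>V\<^esub> b) =
        (\<Oplus>\<^bsub>V\<^esub>b\<in>B. scalar_elem k M (c y b) \<odot>\<^bsub>V\<^esub> b)"
      using B(2) c(1)[OF xy(2)] scalar_elem_closed[OF k, of _ M]
      by (intro V.finsum_cong') (auto intro!: smult_closed simp: Pi_iff)
    then show "x = y" by (rule trans[OF c(2)[OF xy(1)] trans[OF _ sym[OF c(2)[OF xy(2)]]]])
  qed
  obtain W :: "('m \<Rightarrow> 'k, nat \<Rightarrow> 'k) module" where
    W: "left_module (monoid_algebra k M) W" "\<phi> \<in> left_module_hom (monoid_algebra k M) V W"
      "\<phi> ` carrier V = carrier W"
      "inv_into (carrier V) \<phi> \<in> left_module_hom (monoid_algebra k M) W V"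
    by (rule transport_module[OF LV inj])
  show ?thesis
    using that[OF fd_module_image[OF k V W(1-3) inj] W(2) _ W(4)] inj W(3)
    by (simp add: bij_betw_def)
qed

lemma injective_module_extend:
  fixes A :: "('m \<Rightarrow> 'k, 'a, 'e) module_scheme" and B :: "('m \<Rightarrow> 'k, 'b, 'f) module_scheme"
  assumes "ring k" "injective_module k M V" "fd_module k M A" "fd_module k M B"
    and f: "f \<in> left_module_hom (monoid_algebra k M) A B" "inj_on f (carrier A)"
    and g: "g \<in> left_module_hom (monoid_algebra k M) A V"
  shows "\<exists>h \<in> left_module_hom (monoid_algebra k M) B V. \<forall>x\<in>carrier A. h (f x) = g x"
proof -
  let ?H = "\<lambda>V W. left_module_hom (monoid_algebra k M) V W"
  obtain A' :: "('m \<Rightarrow> 'k, nat \<Rightarrow> 'k) module" and \<alpha> where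
    A': "fd_module k M A'" "\<alpha> \<in> ?H A A'" "bij_betw \<alpha> (carrier A) (carrier A')"
      "inv_into (carrier A) \<alpha> \<in> ?H A' A"
    by (rule fd_module_copy[OF assms(1,3)])
  obtain B' :: "('m \<Rightarrow> 'k, nat \<Rightarrow> 'k) module" and \<beta> where
    B': "fd_module k M B'" "\<beta> \<in> ?H B B'" "bij_betw \<beta> (carrier B) (carrier B')"
      "inv_into (carrier B) \<beta> \<in> ?H B' B"
    by (rule fd_module_copy[OF assms(1,4)])
  let ?a = "inv_into (carrier A) \<alpha>"
  let ?f = "\<lambda>x. \<beta> (f (?a x))"
  have a: "bij_betw ?a (carrier A') (carrier A)" using A'(3) by (rule bij_betw_inv_into)
  have fB: "f ` carrier A \<subseteq> carrier B" using f(1) by (auto simp: left_module_hom_def)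
  have 1: "?f \<in> ?H A' B'"
    by (rule left_module_hom_comp[OF left_module_hom_comp[OF A'(4) f(1)] B'(2)])
  have 2: "inj_on ?f (carrier A')"
  proof -
    have "(f \<circ> ?a) ` carrier A' \<subseteq> carrier B"
      using fB bij_betwE[OF a] by auto
    then have "inj_on (\<beta> \<circ> (f \<circ> ?a)) (carrier A')"
      using a f(2) B'(3) by (intro comp_inj_on) (auto simp: bij_betw_def intro: inj_on_subset)
    then show ?thesis by (simp add: o_def)
  qed
  have 3: "(\<lambda>x. g (?a x)) \<in> ?H A' V" by (rule left_module_hom_comp[OF A'(4) g])
  obtain h where h: "h \<in> ?H B' V" "\<forall>x\<in>carrier A'. h (?f x) = g (?a x)"
    using assms(2)[unfolded injective_module_def, THEN conjunct2, rule_format,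
        OF conjI[OF A'(1) B'(1)] 1 3 2] by (elim bexE) (rule that)
  have "h (\<beta> (f x)) = g x" if "x \<in> carrier A" for x
    using h(2)[rule_format, of "\<alpha> x"] that A'(3) by (auto simp: bij_betw_def)
  then show ?thesis by (intro bexI[OF _ left_module_hom_comp[OF B'(2) h(1)]] ballI)
qed

lemma projective_module_lift:
  fixes A :: "('m \<Rightarrow> 'k, 'a, 'e) module_scheme" and B :: "('m \<Rightarrow> 'k, 'b, 'f) module_scheme"
  assumes "ring k" "projective_module k M V" "fd_module k M A" "fd_module k M B"
    and f: "f \<in> left_module_hom (monoid_algebra k M) A B" "f ` carrier A = carrier B"
    and g: "g \<in> left_module_hom (monoid_algebra k M) V B"
  shows "\<exists>h \<in> left_module_hom (monoid_algebra k M) V A. \<forall>x\<in>carrier V. f (h x) = g x"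
proof -
  let ?H = "\<lambda>V W. left_module_hom (monoid_algebra k M) V W"
  obtain A' :: "('m \<Rightarrow> 'k, nat \<Rightarrow> 'k) module" and \<alpha> where
    A': "fd_module k M A'" "\<alpha> \<in> ?H A A'" "bij_betw \<alpha> (carrier A) (carrier A')"
      "inv_into (carrier A) \<alpha> \<in> ?H A' A"
    by (rule fd_module_copy[OF assms(1,3)])
  obtain B' :: "('m \<Rightarrow> 'k, nat \<Rightarrow> 'k) module" and \<beta> where
    B': "fd_module k M B'" "\<beta> \<in> ?H B B'" "bij_betw \<beta> (carrier B) (carrier B')"
      "inv_into (carrier B) \<beta> \<in> ?H B' B"
    by (rule fd_module_copy[OF assms(1,4)])
  let ?a = "inv_into (carrier A) \<alpha>"
  let ?f = "\<lambda>x. \<beta> (f (?a x))"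
  have a: "bij_betw ?a (carrier A') (carrier A)" using A'(3) by (rule bij_betw_inv_into)
  have 1: "?f \<in> ?H A' B'"
    by (rule left_module_hom_comp[OF left_module_hom_comp[OF A'(4) f(1)] B'(2)])
  have "?f ` carrier A' = \<beta> ` f ` ?a ` carrier A'" by (simp add: image_image)
  then have 2: "?f ` carrier A' = carrier B'"
    using a f(2) B'(3) by (simp add: bij_betw_def)
  have 3: "(\<lambda>x. \<beta> (g x)) \<in> ?H V B'" by (rule left_module_hom_comp[OF g B'(2)])
  obtain h where h: "h \<in> ?H V A'" "\<forall>x\<in>carrier V. ?f (h x) = \<beta> (g x)"
    using assms(2)[unfolded projective_module_def, THEN conjunct2, rule_format,
        OF conjI[OF A'(1) B'(1)] 1 3 2] by (elim bexE) (rule that)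
  have "f (?a (h x)) = g x" if x: "x \<in> carrier V" for x
  proof -
    have hx: "?a (h x) \<in> carrier A"
      using x h(1) bij_betwE[OF a] by (auto simp: left_module_hom_def)
    have "f (?a (h x)) \<in> carrier B" using hx f(2) by blast
    moreover have "g x \<in> carrier B" using x g by (auto simp: left_module_hom_def)
    moreover have "\<beta> (f (?a (h x))) = \<beta> (g x)" using h(2) x by (rule bspec)
    ultimately show ?thesis
      using inj_onD[OF bij_betw_imp_inj_on[OF B'(3)]] by simp
  qed
  then show ?thesis by (intro bexI[OF _ left_module_hom_comp[OF h(1) A'(4)]] ballI)
qed

end

theory Submission
  imports Defs
begin

text \<open>Let \<open>G\<close> be the group of units of \<open>M\<close> and \<open>P = kG e\<close> with \<open>e\<close> a nonzero idempotent of \<open>kG\<close>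
  for which \<open>kG e\<close> has least dimension; then \<open>P\<close> is projective and indecomposable. Idempotents of
  \<open>M\<close> commute, so the product \<open>\<eta>\<close> of all \<open>1 - f\<close> over the idempotents \<open>f \<noteq> 1\<close> annihilates every
  nonunit \<open>m\<close> from the left, because \<open>m = f m\<close> with \<open>f = m m'\<close> for the inverse \<open>m'\<close> of \<open>m\<close>, and
  \<open>f \<noteq> 1\<close> by finiteness. On the other hand, \<open>\<eta>\<close> acts on \<open>Ind(P)\<close> as the identity.
  A homomorphism \<open>g\<close> from \<open>A\<close> to \<open>Ind(P) \<subseteq> kG\<close> is determined by the functional \<open>x \<mapsto> g(x)(1)\<close>.
  Given an embedding of \<open>A\<close> into \<open>B\<close>, extend this functional to a linear functional \<open>\<mu>\<close> on \<open>B\<close>;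
  then \<open>b \<mapsto> (\<Sum>u\<in>G. \<mu>(\<eta> v b) u) e\<close>, with \<open>v\<close> the inverse of \<open>u\<close>, extends \<open>g\<close> to \<open>B\<close>.\<close>

section \<open>The monoid algebra of a finite monoid\<close>

text \<open>The element c m of kM. Basis elements and scalars are the special cases c = 1 and m = 1,
  so that one product rule covers both, and every element of kM is a sum of such terms.\<close>

definition monomial ::
    "('k, 'c) ring_scheme \<Rightarrow> ('m, 'd) monoid_scheme \<Rightarrow> 'm \<Rightarrow> 'k \<Rightarrow> 'm \<Rightarrow> 'k" where
  "monomial k M m c = (\<lambda>x\<in>carrier M. if x = m then c else \<zero>\<^bsub>k\<^esub>)"

lemma basis_elem_eq_monomial: "basis_elem k M m = monomial k M m \<one>\<^bsub>k\<^esub>"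
  by (simp add: basis_elem_def monomial_def)

lemma scalar_elem_eq_monomial: "scalar_elem k M c = monomial k M \<one>\<^bsub>M\<^esub> c"
  by (simp add: scalar_elem_def monomial_def)

lemma monoid_algebra_one: "\<one>\<^bsub>monoid_algebra k M\<^esub> = monomial k M \<one>\<^bsub>M\<^esub> \<one>\<^bsub>k\<^esub>"
  by (simp add: monoid_algebra_def monomial_def)

lemma monoid_algebra_zero: "\<zero>\<^bsub>monoid_algebra k M\<^esub> = (\<lambda>m\<in>carrier M. \<zero>\<^bsub>k\<^esub>)"
  by (simp add: monoid_algebra_def)

lemma monoid_algebra_carrier: "carrier (monoid_algebra k M) = carrier M \<rightarrow>\<^sub>E carrier k"
  by (simp add: monoid_algebra_def)

lemma monoid_algebra_add:
  "a \<oplus>\<^bsub>monoid_algebra k M\<^esub> b = (\<lambda>m\<in>carrier M. a m \<oplus>\<^bsub>k\<^esub> b m)"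
  by (simp add: monoid_algebra_def)

lemma monoid_algebra_mult:
  "a \<otimes>\<^bsub>monoid_algebra k M\<^esub> b = (\<lambda>m\<in>carrier M.
     \<Oplus>\<^bsub>k\<^esub>p\<in>{p \<in> carrier M \<times> carrier M. fst p \<otimes>\<^bsub>M\<^esub> snd p = m}. a (fst p) \<otimes>\<^bsub>k\<^esub> b (snd p))"
  by (simp add: monoid_algebra_def)

locale finite_monoid_algebra = k: field k + M: monoid M
  for k :: "('k, 'c) ring_scheme" and M :: "('m, 'd) monoid_scheme" +
  assumes finite_carrier: "finite (carrier M)"
begin

abbreviation "kM \<equiv> monoid_algebra k M"

lemma coeff_closed: "\<lbrakk>a \<in> carrier kM; m \<in> carrier M\<rbrakk> \<Longrightarrow> a m \<in> carrier k"
  by (auto simp: monoid_algebra_carrier)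

lemma monoid_algebra_eqI:
  "\<lbrakk>a \<in> carrier kM; b \<in> carrier kM; \<And>m. m \<in> carrier M \<Longrightarrow> a m = b m\<rbrakk> \<Longrightarrow> a = b"
  by (auto simp: monoid_algebra_carrier intro: PiE_ext)

lemma restrict_closed:
  "(\<And>m. m \<in> carrier M \<Longrightarrow> f m \<in> carrier k) \<Longrightarrow> (\<lambda>m\<in>carrier M. f m) \<in> carrier kM"
  by (auto simp: monoid_algebra_carrier)

lemma monomial_closed: "c \<in> carrier k \<Longrightarrow> monomial k M m c \<in> carrier kM"
  by (auto simp: monoid_algebra_carrier monomial_def)

lemma monomial_add:
  "\<lbrakk>c \<in> carrier k; d \<in> carrier k\<rbrakk> \<Longrightarrow>
     monomial k M m c \<oplus>\<^bsub>kM\<^esub> monomial k M m d = monomial k M m (c \<oplus>\<^bsub>k\<^esub> d)"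
  by (auto simp: monoid_algebra_add monomial_def fun_eq_iff)

lemma monomial_zero: "monomial k M m \<zero>\<^bsub>k\<^esub> = \<zero>\<^bsub>kM\<^esub>"
  by (auto simp: monoid_algebra_zero monomial_def fun_eq_iff)

text \<open>An element is built from its coefficients one point of \<open>carrier M\<close> at a
  time, starting from zero, which is itself a monomial with coefficient zero. Identities that are
  additive in each argument thus need checking on monomials only.\<close>

lemma monoid_algebra_induct [consumes 1, case_names monomial add]:
  assumes a: "a \<in> carrier kM"
    and monomial: "\<And>m c. \<lbrakk>m \<in> carrier M; c \<in> carrier k\<rbrakk> \<Longrightarrow> P (monomial k M m c)"
    and add: "\<And>a b. \<lbrakk>a \<in> carrier kM; b \<in> carrier kM; P a; P b\<rbrakk> \<Longrightarrow> P (a \<oplus>\<^bsub>kM\<^esub> b)"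
  shows "P a"
proof -
  let ?r = "\<lambda>S. \<lambda>x\<in>carrier M. if x \<in> S then a x else \<zero>\<^bsub>k\<^esub>"
  have "P (?r S)" if "finite S" "S \<subseteq> carrier M" for S
    using that
  proof (induction S rule: finite_induct)
    case empty
    have "?r {} = monomial k M \<one>\<^bsub>M\<^esub> \<zero>\<^bsub>k\<^esub>" by (auto simp: monomial_def fun_eq_iff)
    then show ?case using monomial[of "\<one>\<^bsub>M\<^esub>" "\<zero>\<^bsub>k\<^esub>"] by simp
  next
    case (insert m S)
    have eq: "?r (insert m S) = monomial k M m (a m) \<oplus>\<^bsub>kM\<^esub> ?r S"
      using insert coeff_closed[OF a]
      by (auto simp: monomial_def monoid_algebra_add fun_eq_iff)
    have "?r S \<in> carrier kM"
      using a by (auto simp: monoid_algebra_carrier)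
    moreover have "P (?r S)" "m \<in> carrier M"
      using insert.IH insert.prems by blast+
    ultimately show ?case
      unfolding eq using a by (intro add monomial monomial_closed coeff_closed)
  qed
  from this[OF finite_carrier order.refl] have "P (?r (carrier M))" .
  also have "?r (carrier M) = a"
    using a by (auto simp: monoid_algebra_carrier fun_eq_iff)
  finally show ?thesis .
qed

section \<open>The convolution product and the ring structure\<close>

lemma finite_factorisations: "finite {p \<in> carrier M \<times> carrier M. fst p \<otimes>\<^bsub>M\<^esub> snd p = m}"
  using finite_carrier by simp

lemma mult_closed: "\<lbrakk>a \<in> carrier kM; b \<in> carrier kM\<rbrakk> \<Longrightarrow> a \<otimes>\<^bsub>kM\<^esub> b \<in> carrier kM"
  unfolding monoid_algebra_mult
  by (intro restrict_closed k.finsum_closed) (auto simp: coeff_closed)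

lemma add_closed: "\<lbrakk>a \<in> carrier kM; b \<in> carrier kM\<rbrakk> \<Longrightarrow> a \<oplus>\<^bsub>kM\<^esub> b \<in> carrier kM"
  by (auto simp: monoid_algebra_carrier monoid_algebra_add)

text \<open>At x the convolution sum has at most one nonzero term, the one for the pair (m, n),
  which occurs exactly when m n = x.\<close>

lemma monomial_mult:
  assumes "m \<in> carrier M" "n \<in> carrier M" "c \<in> carrier k" "d \<in> carrier k"
  shows "monomial k M m c \<otimes>\<^bsub>kM\<^esub> monomial k M n d = monomial k M (m \<otimes>\<^bsub>M\<^esub> n) (c \<otimes>\<^bsub>k\<^esub> d)"
proof (rule monoid_algebra_eqI)
  fix x assume x: "x \<in> carrier M"
  let ?F = "{p \<in> carrier M \<times> carrier M. fst p \<otimes>\<^bsub>M\<^esub> snd p = x}"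
  have "(\<Oplus>\<^bsub>k\<^esub>p\<in>?F. monomial k M m c (fst p) \<otimes>\<^bsub>k\<^esub> monomial k M n d (snd p)) =
      (\<Oplus>\<^bsub>k\<^esub>p\<in>?F. if p = (m, n) then c \<otimes>\<^bsub>k\<^esub> d else \<zero>\<^bsub>k\<^esub>)"
    using assms by (intro k.finsum_cong') (auto simp: monomial_def)
  also have "\<dots> = monomial k M (m \<otimes>\<^bsub>M\<^esub> n) (c \<otimes>\<^bsub>k\<^esub> d) x"
  proof (cases "m \<otimes>\<^bsub>M\<^esub> n = x")
    case True
    then show ?thesis
      using assms x k.add.finprod_singleton_swap[of "(m, n)" ?F "\<lambda>p. c \<otimes>\<^bsub>k\<^esub> d"]
        finite_factorisations[of x]
      by (simp add: monomial_def)
  next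
    case False
    then have "(\<Oplus>\<^bsub>k\<^esub>p\<in>?F. if p = (m, n) then c \<otimes>\<^bsub>k\<^esub> d else \<zero>\<^bsub>k\<^esub>) = (\<Oplus>\<^bsub>k\<^esub>p\<in>?F. \<zero>\<^bsub>k\<^esub>)"
      by (intro k.finsum_cong') auto
    then show ?thesis using False x by (simp add: monomial_def)
  qed
  finally show "(monomial k M m c \<otimes>\<^bsub>kM\<^esub> monomial k M n d) x =
      monomial k M (m \<otimes>\<^bsub>M\<^esub> n) (c \<otimes>\<^bsub>k\<^esub> d) x"
    using x by (simp add: monoid_algebra_mult)
qed (use assms in \<open>auto intro!: mult_closed monomial_closed\<close>)

lemma add_mult_distrib:
  assumes "a \<in> carrier kM" "b \<in> carrier kM" "c \<in> carrier kM"
  shows "(a \<oplus>\<^bsub>kM\<^esub> b) \<otimes>\<^bsub>kM\<^esub> c = a \<otimes>\<^bsub>kM\<^esub> c \<oplus>\<^bsub>kM\<^esub> b \<otimes>\<^bsub>kM\<^esub> c"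
proof (rule monoid_algebra_eqI)
  fix x assume x: "x \<in> carrier M"
  let ?F = "{p \<in> carrier M \<times> carrier M. fst p \<otimes>\<^bsub>M\<^esub> snd p = x}"
  have "(\<Oplus>\<^bsub>k\<^esub>p\<in>?F. (a \<oplus>\<^bsub>kM\<^esub> b) (fst p) \<otimes>\<^bsub>k\<^esub> c (snd p)) =
      (\<Oplus>\<^bsub>k\<^esub>p\<in>?F. a (fst p) \<otimes>\<^bsub>k\<^esub> c (snd p) \<oplus>\<^bsub>k\<^esub> b (fst p) \<otimes>\<^bsub>k\<^esub> c (snd p))"
    using assms by (intro k.finsum_cong')
      (auto simp: monoid_algebra_add coeff_closed k.l_distr)
  also have "\<dots> = (\<Oplus>\<^bsub>k\<^esub>p\<in>?F. a (fst p) \<otimes>\<^bsub>k\<^esub> c (snd p)) \<oplus>\<^bsub>k\<^esub> (\<Oplus>\<^bsub>k\<^esub>p\<in>?F. b (fst p) \<otimes>\<^bsub>k\<^esub> c (snd p))"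
    using assms by (intro k.finsum_addf) (auto simp: coeff_closed)
  finally show "((a \<oplus>\<^bsub>kM\<^esub> b) \<otimes>\<^bsub>kM\<^esub> c) x = (a \<otimes>\<^bsub>kM\<^esub> c \<oplus>\<^bsub>kM\<^esub> b \<otimes>\<^bsub>kM\<^esub> c) x"
    using x by (simp add: monoid_algebra_mult monoid_algebra_add)
qed (use assms in \<open>auto intro!: mult_closed add_closed\<close>)

lemma mult_add_distrib:
  assumes "a \<in> carrier kM" "b \<in> carrier kM" "c \<in> carrier kM"
  shows "c \<otimes>\<^bsub>kM\<^esub> (a \<oplus>\<^bsub>kM\<^esub> b) = c \<otimes>\<^bsub>kM\<^esub> a \<oplus>\<^bsub>kM\<^esub> c \<otimes>\<^bsub>kM\<^esub> b"
proof (rule monoid_algebra_eqI)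
  fix x assume x: "x \<in> carrier M"
  let ?F = "{p \<in> carrier M \<times> carrier M. fst p \<otimes>\<^bsub>M\<^esub> snd p = x}"
  have "(\<Oplus>\<^bsub>k\<^esub>p\<in>?F. c (fst p) \<otimes>\<^bsub>k\<^esub> (a \<oplus>\<^bsub>kM\<^esub> b) (snd p)) =
      (\<Oplus>\<^bsub>k\<^esub>p\<in>?F. c (fst p) \<otimes>\<^bsub>k\<^esub> a (snd p) \<oplus>\<^bsub>k\<^esub> c (fst p) \<otimes>\<^bsub>k\<^esub> b (snd p))"
    using assms by (intro k.finsum_cong')
      (auto simp: monoid_algebra_add coeff_closed k.r_distr)
  also have "\<dots> = (\<Oplus>\<^bsub>k\<^esub>p\<in>?F. c (fst p) \<otimes>\<^bsub>k\<^esub> a (snd p)) \<oplus>\<^bsub>k\<^esub> (\<Oplus>\<^bsub>k\<^esub>p\<in>?F. c (fst p) \<otimes>\<^bsub>k\<^esub> b (snd p))"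
    using assms by (intro k.finsum_addf) (auto simp: coeff_closed)
  finally show "(c \<otimes>\<^bsub>kM\<^esub> (a \<oplus>\<^bsub>kM\<^esub> b)) x = (c \<otimes>\<^bsub>kM\<^esub> a \<oplus>\<^bsub>kM\<^esub> c \<otimes>\<^bsub>kM\<^esub> b) x"
    using x by (simp add: monoid_algebra_mult monoid_algebra_add)
qed (use assms in \<open>auto intro!: mult_closed add_closed\<close>)

text \<open>Both sides are additive in each argument, so three nested inductions reduce the claim to
  monomials, where it is associativity in M and in k.\<close>

lemma mult_assoc:
  assumes "a \<in> carrier kM" "b \<in> carrier kM" "c \<in> carrier kM"
  shows "a \<otimes>\<^bsub>kM\<^esub> b \<otimes>\<^bsub>kM\<^esub> c = a \<otimes>\<^bsub>kM\<^esub> (b \<otimes>\<^bsub>kM\<^esub> c)"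
  using assms(1)
proof (induction a rule: monoid_algebra_induct)
  case m: (monomial m r)
  show ?case
    using assms(2)
  proof (induction b rule: monoid_algebra_induct)
    case n: (monomial n s)
    show ?case
      using assms(3)
    proof (induction c rule: monoid_algebra_induct)
      case (monomial l t)
      with m n show ?case by (simp add: monomial_mult M.m_assoc k.m_assoc)
    qed (use m n in \<open>simp add: mult_add_distrib monomial_closed mult_closed\<close>)
  qed (use m assms in \<open>simp add: mult_add_distrib add_mult_distrib monomial_closed mult_closed\<close>)
qed (use assms in \<open>simp add: add_mult_distrib mult_closed\<close>)

lemma mult_one_left: "a \<in> carrier kM \<Longrightarrow> \<one>\<^bsub>kM\<^esub> \<otimes>\<^bsub>kM\<^esub> a = a"
  by (induction a rule: monoid_algebra_induct)
    (simp_all add: monoid_algebra_one monomial_mult mult_add_distrib monomial_closed)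

lemma mult_one_right: "a \<in> carrier kM \<Longrightarrow> a \<otimes>\<^bsub>kM\<^esub> \<one>\<^bsub>kM\<^esub> = a"
  by (induction a rule: monoid_algebra_induct)
    (simp_all add: monoid_algebra_one monomial_mult add_mult_distrib monomial_closed)

sublocale kM: ring kM
proof (rule ringI)
  show "abelian_group kM"
  proof (rule abelian_groupI)
    fix a assume "a \<in> carrier kM"
    then show "\<exists>b\<in>carrier kM. b \<oplus>\<^bsub>kM\<^esub> a = \<zero>\<^bsub>kM\<^esub>"
      by (intro bexI[of _ "\<lambda>m\<in>carrier M. \<ominus>\<^bsub>k\<^esub> a m"])
        (auto simp: monoid_algebra_add monoid_algebra_zero fun_eq_iff k.l_neg coeff_closed
          intro!: restrict_closed)
  next
    fix a assume "a \<in> carrier kM"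
    then show "\<zero>\<^bsub>kM\<^esub> \<oplus>\<^bsub>kM\<^esub> a = a"
      by (intro monoid_algebra_eqI)
        (auto simp: monoid_algebra_add monoid_algebra_zero coeff_closed intro!: restrict_closed)
  qed (auto simp: monoid_algebra_add monoid_algebra_zero fun_eq_iff k.a_ac coeff_closed
      intro!: restrict_closed)
  show "monoid kM"
    by (intro monoidI)
      (simp_all add: mult_closed mult_assoc mult_one_left mult_one_right,
        simp add: monoid_algebra_one monomial_closed)
qed (auto simp: add_mult_distrib mult_add_distrib)

section \<open>Scalars in the monoid algebra\<close>

lemma scalar_elem_closed: "c \<in> carrier k \<Longrightarrow> scalar_elem k M c \<in> carrier kM"
  by (simp add: scalar_elem_eq_monomial monomial_closed)

lemma scalar_mult_monomial:
  "\<lbrakk>m \<in> carrier M; c \<in> carrier k; d \<in> carrier k\<rbrakk> \<Longrightarrow>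
     scalar_elem k M c \<otimes>\<^bsub>kM\<^esub> monomial k M m d = monomial k M m (c \<otimes>\<^bsub>k\<^esub> d)"
  by (simp add: scalar_elem_eq_monomial monomial_mult)

text \<open>Scalars are central: on a monomial this is commutativity of k together with the unit
  laws of M.\<close>

lemma scalar_elem_commute:
  assumes "c \<in> carrier k" "a \<in> carrier kM"
  shows "scalar_elem k M c \<otimes>\<^bsub>kM\<^esub> a = a \<otimes>\<^bsub>kM\<^esub> scalar_elem k M c"
  using assms(2)
  by (induction a rule: monoid_algebra_induct)
    (simp_all add: assms scalar_elem_closed scalar_elem_eq_monomial monomial_mult k.m_comm
      kM.l_distr kM.r_distr monomial_closed)

lemma scalar_elem_mult_coeff:
  assumes "c \<in> carrier k" "a \<in> carrier kM" "m \<in> carrier M"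
  shows "(scalar_elem k M c \<otimes>\<^bsub>kM\<^esub> a) m = c \<otimes>\<^bsub>k\<^esub> a m"
  using assms(2)
proof (induction a rule: monoid_algebra_induct)
  case (monomial n d)
  with assms show ?case by (simp add: scalar_mult_monomial) (simp add: monomial_def)
next
  case (add a b)
  with assms show ?case
    by (simp add: kM.r_distr scalar_elem_closed) (simp add: monoid_algebra_add k.r_distr coeff_closed)
qed

text \<open>This map makes every kM-module a vector space over k, and its image is the subfield over
  which dimensions in kM are taken.\<close>

lemma scalar_elem_ring_hom: "scalar_elem k M \<in> ring_hom k kM"
  by (intro ring_hom_memI)
    (simp_all add: scalar_elem_eq_monomial monomial_closed monomial_mult monomial_add
      monoid_algebra_one)

end

section \<open>Linear functionals and finite-dimensional modules\<close>

context module
begin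

text \<open>Only the values on U are constrained, since functionals are extended one vector at a
  time.\<close>

definition linear_functional_on :: "'c set \<Rightarrow> ('c \<Rightarrow> 'a) \<Rightarrow> bool" where
  "linear_functional_on U l \<longleftrightarrow> l \<in> U \<rightarrow> carrier R \<and>
     (\<forall>x\<in>U. \<forall>y\<in>U. l (x \<oplus>\<^bsub>M\<^esub> y) = l x \<oplus> l y) \<and> (\<forall>c\<in>carrier R. \<forall>x\<in>U. l (c \<odot>\<^bsub>M\<^esub> x) = c \<otimes> l x)"

end

text \<open>If v is outside U, the sum of U and the line kv is direct, and composing l with the
  projection onto U gives an extension that vanishes at v.\<close>

lemma linear_functional_extend_step:
  fixes k :: "('k, 'c) ring_scheme" (structure) and V :: "('k, 'v, 'e) module_scheme" (structure)
  assumes "field k" "module k V" and U: "submodule U k V"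
    and l: "module.linear_functional_on k V U l" and v: "v \<in> carrier V"
  shows "\<exists>U' l'. submodule U' k V \<and> U \<subseteq> U' \<and> v \<in> U' \<and> module.linear_functional_on k V U' l' \<and>
    (\<forall>x\<in>U. l' x = l x)"
proof (cases "v \<in> U")
  case True
  with U l show ?thesis by blast
next
  case False
  interpret module k V by fact
  interpret field k by fact
  note UE = submoduleE[OF U]
  have UV: "x \<in> carrier V" if "x \<in> U" for x using that UE(1) by blast
  have Udiff: "x \<ominus>\<^bsub>V\<^esub> y \<in> U" if "x \<in> U" "y \<in> U" for x y
    using that UE(3,5) by (simp add: M.minus_eq)
  \<comment> \<open>Two representations of the same vector force (c - c') v into U. If c - c' were
    nonzero, dividing by it would put v into U.\<close>
  have unique: "u = u'" if u: "u \<in> U" "u' \<in> U" and c: "c \<in> carrier k" "c' \<in> carrier k"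
    and eq: "u \<oplus>\<^bsub>V\<^esub> c \<odot>\<^bsub>V\<^esub> v = u' \<oplus>\<^bsub>V\<^esub> c' \<odot>\<^bsub>V\<^esub> v" for u u' c c'
  proof -
    have "(c \<ominus> c') \<odot>\<^bsub>V\<^esub> v = c \<odot>\<^bsub>V\<^esub> v \<ominus>\<^bsub>V\<^esub> c' \<odot>\<^bsub>V\<^esub> v"
      using c v by (simp add: a_minus_def smult_l_distr smult_l_minus)
    also have "c \<odot>\<^bsub>V\<^esub> v = \<ominus>\<^bsub>V\<^esub> u \<oplus>\<^bsub>V\<^esub> (u' \<oplus>\<^bsub>V\<^esub> c' \<odot>\<^bsub>V\<^esub> v)"
      using u c v by (simp add: UV M.r_neg1 flip: eq)
    also have "\<dots> \<ominus>\<^bsub>V\<^esub> c' \<odot>\<^bsub>V\<^esub> v = u' \<ominus>\<^bsub>V\<^esub> u"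
      using u c v by (simp add: UV a_minus_def M.a_assoc M.r_neg) (simp add: UV M.a_comm)
    finally have cv: "(c \<ominus> c') \<odot>\<^bsub>V\<^esub> v \<in> U" using Udiff[OF u(2,1)] by simp
    have "c \<ominus> c' = \<zero>"
    proof (rule ccontr)
      assume "c \<ominus> c' \<noteq> \<zero>"
      then have "c \<ominus> c' \<in> Units k" using c by (simp add: field_Units)
      then have "inv (c \<ominus> c') \<odot>\<^bsub>V\<^esub> ((c \<ominus> c') \<odot>\<^bsub>V\<^esub> v) = v" "inv (c \<ominus> c') \<in> carrier k"
        using c v by (simp_all flip: smult_assoc1)
      with UE(4)[OF _ cv] False show False by metis
    qed
    then have "c = c'" using c by simp
    with eq show ?thesis using u c v UV by simp
  qed
  define U' where "U' = {u \<oplus>\<^bsub>V\<^esub> c \<odot>\<^bsub>V\<^esub> v | u c. u \<in> U \<and> c \<in> carrier k}"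
  \<comment> \<open>The description picks out the U-component, which \<open>unique\<close> shows to
    be well defined.\<close>
  define l' where "l' x = l (THE u. u \<in> U \<and> (\<exists>c\<in>carrier k. x = u \<oplus>\<^bsub>V\<^esub> c \<odot>\<^bsub>V\<^esub> v))" for x
  have l': "l' (u \<oplus>\<^bsub>V\<^esub> c \<odot>\<^bsub>V\<^esub> v) = l u" if "u \<in> U" "c \<in> carrier k" for u c
  proof -
    have "(THE w. w \<in> U \<and> (\<exists>d\<in>carrier k. u \<oplus>\<^bsub>V\<^esub> c \<odot>\<^bsub>V\<^esub> v = w \<oplus>\<^bsub>V\<^esub> d \<odot>\<^bsub>V\<^esub> v)) = u"
      using that unique by (intro the_equality) blast+
    then show ?thesis by (simp add: l'_def)
  qed
  have zero: "\<zero>\<^bsub>V\<^esub> \<in> U" using UE(2,5) Udiff by (metis M.r_neg M.minus_eq UV ex_in_conv)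
  have add: "(u \<oplus>\<^bsub>V\<^esub> c \<odot>\<^bsub>V\<^esub> v) \<oplus>\<^bsub>V\<^esub> (u' \<oplus>\<^bsub>V\<^esub> c' \<odot>\<^bsub>V\<^esub> v) = (u \<oplus>\<^bsub>V\<^esub> u') \<oplus>\<^bsub>V\<^esub> (c \<oplus> c') \<odot>\<^bsub>V\<^esub> v"
    if "u \<in> U" "u' \<in> U" "c \<in> carrier k" "c' \<in> carrier k" for u u' c c'
    using that v by (simp add: smult_l_distr UV M.a_ac)
  have smult: "d \<odot>\<^bsub>V\<^esub> (u \<oplus>\<^bsub>V\<^esub> c \<odot>\<^bsub>V\<^esub> v) = d \<odot>\<^bsub>V\<^esub> u \<oplus>\<^bsub>V\<^esub> (d \<otimes> c) \<odot>\<^bsub>V\<^esub> v"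
    if "u \<in> U" "c \<in> carrier k" "d \<in> carrier k" for u c d
    using that v by (simp add: smult_r_distr smult_assoc1 UV)
  have neg: "\<ominus>\<^bsub>V\<^esub> (u \<oplus>\<^bsub>V\<^esub> c \<odot>\<^bsub>V\<^esub> v) = \<ominus>\<^bsub>V\<^esub> u \<oplus>\<^bsub>V\<^esub> (\<ominus> c) \<odot>\<^bsub>V\<^esub> v"
    if "u \<in> U" "c \<in> carrier k" for u c
    using that v by (simp add: smult_l_minus UV M.minus_add)
  have in_U': "u \<oplus>\<^bsub>V\<^esub> c \<odot>\<^bsub>V\<^esub> v \<in> U'" if "u \<in> U" "c \<in> carrier k" for u c
    using that by (auto simp: U'_def)
  have "submodule U' k V"
  proof (rule submoduleI)
    show "U' \<subseteq> carrier V" using v by (auto simp: U'_def UV)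
    show "\<zero>\<^bsub>V\<^esub> \<in> U'" using in_U'[OF zero R.zero_closed] v by simp
  next
    fix x assume "x \<in> U'"
    then show "\<ominus>\<^bsub>V\<^esub> x \<in> U'" by (auto simp: U'_def neg) (metis UE(3) R.a_inv_closed)
  next
    fix x y assume "x \<in> U'" "y \<in> U'"
    then show "x \<oplus>\<^bsub>V\<^esub> y \<in> U'" by (auto simp: U'_def add) (metis UE(5) R.a_closed)
  next
    fix d x assume "d \<in> carrier k" "x \<in> U'"
    then show "d \<odot>\<^bsub>V\<^esub> x \<in> U'" by (auto simp: U'_def smult) (metis UE(4) R.m_closed)
  qed
  moreover have "U \<subseteq> U'"
    using in_U'[OF _ R.zero_closed] v UV by fastforce
  moreover have "v \<in> U'" using in_U'[OF zero R.one_closed] v by simp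
  moreover have "linear_functional_on U' l'"
    using l UE(4,5) unfolding linear_functional_on_def
    by (auto simp: U'_def l' add smult Pi_iff)
  moreover have "l' x = l x" if "x \<in> U" for x
    using l'[OF that R.zero_closed] v UV[OF that] by simp
  ultimately show ?thesis by blast
qed

text \<open>A finite spanning set turns the extension into an induction that adjoins one vector at a
  time; a submodule containing a spanning set is everything.\<close>

lemma linear_functional_extend:
  fixes k :: "('k, 'c) ring_scheme" (structure) and V :: "('k, 'v, 'e) module_scheme" (structure)
  assumes "field k" "module k V" and B: "finite B" "B \<subseteq> carrier V"
    and span: "\<forall>v\<in>carrier V. \<exists>c\<in>B \<rightarrow> carrier k. v = (\<Oplus>\<^bsub>V\<^esub>b\<in>B. c b \<odot>\<^bsub>V\<^esub> b)"
    and U: "submodule U k V" and l: "module.linear_functional_on k V U l"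
  obtains l' where "module.linear_functional_on k V (carrier V) l'" "\<And>x. x \<in> U \<Longrightarrow> l' x = l x"
proof -
  interpret module k V by fact
  have "\<exists>U' l'. submodule U' k V \<and> U \<subseteq> U' \<and> S \<subseteq> U' \<and> linear_functional_on U' l' \<and>
      (\<forall>x\<in>U. l' x = l x)" if "finite S" "S \<subseteq> carrier V" for S
    using that
  proof (induction S rule: finite_induct)
    case empty
    then show ?case using U l by blast
  next
    case (insert v S)
    then obtain U1 l1 where 1: "submodule U1 k V" "U \<subseteq> U1" "S \<subseteq> U1" "linear_functional_on U1 l1"
        "\<forall>x\<in>U. l1 x = l x"
      by blast
    obtain U2 l2 where "submodule U2 k V" "U1 \<subseteq> U2" "v \<in> U2" "linear_functional_on U2 l2"
        "\<forall>x\<in>U1. l2 x = l1 x"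
      using linear_functional_extend_step[OF assms(1,2) 1(1,4), of v] insert.prems by blast
    with 1 show ?case by (intro exI[of _ U2] exI[of _ l2]) auto
  qed
  from this[OF B] obtain U' l' where U': "submodule U' k V" "B \<subseteq> U'" "linear_functional_on U' l'"
      "\<forall>x\<in>U. l' x = l x" by blast
  have sum: "(\<Oplus>\<^bsub>V\<^esub>b\<in>S. c b \<odot>\<^bsub>V\<^esub> b) \<in> U'" if "finite S" "S \<subseteq> B" "c \<in> B \<rightarrow> carrier k" for S c
    using that
  proof (induction S rule: finite_induct)
    case empty
    then show ?case using subgroup.one_closed[OF submodule.axioms(1)[OF U'(1)]] by simp
  next
    case (insert s S)
    then have "(\<lambda>b. c b \<odot>\<^bsub>V\<^esub> b) \<in> S \<rightarrow> carrier V" "c s \<odot>\<^bsub>V\<^esub> s \<in> carrier V"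
      using B(2) by (auto intro!: smult_closed)
    with insert show ?case
      using submoduleE(4,5)[OF U'(1)] U'(2) by (simp add: Pi_iff subset_iff)
  qed
  have "carrier V = U'"
    using span sum[OF B(1) order.refl] submoduleE(1)[OF U'(1)] by fastforce
  with U' show ?thesis using that by blast
qed

text \<open>Restricting the action of kM to scalars gives a vector space over k, to which the locale
  \<open>module\<close>, whose base ring is commutative, applies.\<close>

definition scalar_module ::
    "('k, 'c) ring_scheme \<Rightarrow> ('m, 'd) monoid_scheme \<Rightarrow> ('m \<Rightarrow> 'k, 'v, 'e) module_scheme
      \<Rightarrow> ('k, 'v) module" where
  "scalar_module k M V = \<lparr>carrier = carrier V, monoid.mult = monoid.mult V,
     monoid.one = monoid.one V, ring.zero = \<zero>\<^bsub>V\<^esub>, ring.add = ring.add V,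
     smult = (\<lambda>c v. scalar_elem k M c \<odot>\<^bsub>V\<^esub> v)\<rparr>"

lemma scalar_module_simps [simp]:
  "carrier (scalar_module k M V) = carrier V"
  "\<zero>\<^bsub>scalar_module k M V\<^esub> = \<zero>\<^bsub>V\<^esub>"
  "x \<oplus>\<^bsub>scalar_module k M V\<^esub> y = x \<oplus>\<^bsub>V\<^esub> y"
  "c \<odot>\<^bsub>scalar_module k M V\<^esub> x = scalar_elem k M c \<odot>\<^bsub>V\<^esub> x"
  "finsum (scalar_module k M V) f S = finsum V f S"
  by (simp_all add: scalar_module_def finsum_def finprod_def)

lemma (in finite_monoid_algebra) module_scalar_module:
  assumes "left_module kM V"
  shows "module k (scalar_module k M V)"
proof -
  interpret V: left_module kM V by fact
  note hom = ring_hom_closed[OF scalar_elem_ring_hom] ring_hom_add[OF scalar_elem_ring_hom]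
    ring_hom_mult[OF scalar_elem_ring_hom] ring_hom_one[OF scalar_elem_ring_hom]
  have "abelian_group (scalar_module k M V)"
    by (rule abelian_groupI) (auto simp: V.V.a_ac intro: V.V.add.l_inv_ex)
  then show ?thesis
    by (intro module.intro module_axioms.intro k.is_cring)
      (simp_all add: hom V.smult_closed V.smult_l_distr V.smult_r_distr V.smult_assoc V.smult_one)
qed

text \<open>The finitely many translates m v of the generator span, since the elements m of M span
  kM.\<close>

lemma (in finite_monoid_algebra) fd_module_cyclic:
  assumes V: "left_module kM V" and v: "v \<in> carrier V"
    and gen: "\<And>x. x \<in> carrier V \<Longrightarrow> \<exists>a\<in>carrier kM. x = a \<odot>\<^bsub>V\<^esub> v"
  shows "fd_module k M V"
proof -
  interpret V: left_module kM V by fact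
  define B where "B = (\<lambda>m. basis_elem k M m \<odot>\<^bsub>V\<^esub> v) ` carrier M"
  let ?L = "\<lambda>c. \<Oplus>\<^bsub>V\<^esub>b\<in>B. scalar_elem k M (c b) \<odot>\<^bsub>V\<^esub> b"
  have B: "finite B" "B \<subseteq> carrier V"
    using v finite_carrier
    by (auto simp: B_def basis_elem_eq_monomial monomial_closed intro!: V.smult_closed)
  have smult: "scalar_elem k M d \<odot>\<^bsub>V\<^esub> b \<in> carrier V" if "d \<in> carrier k" "b \<in> B" for d b
    using that B(2) by (auto intro!: V.smult_closed scalar_elem_closed)
  have "\<exists>c\<in>B \<rightarrow> carrier k. a \<odot>\<^bsub>V\<^esub> v = ?L c" if "a \<in> carrier kM" for a
    using that
  proof (induction a rule: monoid_algebra_induct)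
    case (monomial m d)
    let ?b = "basis_elem k M m \<odot>\<^bsub>V\<^esub> v"
    \<comment> \<open>The coefficients are supported on the single vector m v. \<open>B\<close> is a
      set of vectors, so elements of M with the same translate cause no double counting.\<close>
    let ?c = "\<lambda>b. if b = ?b then d else \<zero>\<^bsub>k\<^esub>"
    have b: "?b \<in> B" using monomial by (simp add: B_def)
    have zero: "scalar_elem k M \<zero>\<^bsub>k\<^esub> = \<zero>\<^bsub>kM\<^esub>"
      by (simp add: scalar_elem_eq_monomial monomial_zero)
    have "?L ?c = (\<Oplus>\<^bsub>V\<^esub>b\<in>B. if b = ?b then scalar_elem k M d \<odot>\<^bsub>V\<^esub> b else \<zero>\<^bsub>V\<^esub>)"
      using B(2) monomial smult
      by (intro V.V.finsum_cong') (auto simp: zero V.smult_l_null)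
    also have "\<dots> = scalar_elem k M d \<odot>\<^bsub>V\<^esub> ?b"
      using b B(1) monomial smult by (intro V.V.add.finprod_singleton_swap) auto
    also have "\<dots> = monomial k M m d \<odot>\<^bsub>V\<^esub> v"
      using monomial v
      by (simp add: basis_elem_eq_monomial scalar_mult_monomial scalar_elem_closed
          monomial_closed flip: V.smult_assoc)
    finally show ?case using monomial by (intro bexI[of _ ?c]) auto
  next
    case (add a b)
    then obtain c d where c: "c \<in> B \<rightarrow> carrier k" "a \<odot>\<^bsub>V\<^esub> v = ?L c"
      and d: "d \<in> B \<rightarrow> carrier k" "b \<odot>\<^bsub>V\<^esub> v = ?L d"
      by blast
    have "?L (\<lambda>b. c b \<oplus>\<^bsub>k\<^esub> d b) =
        (\<Oplus>\<^bsub>V\<^esub>b\<in>B. scalar_elem k M (c b) \<odot>\<^bsub>V\<^esub> b \<oplus>\<^bsub>V\<^esub> scalar_elem k M (d b) \<odot>\<^bsub>V\<^esub> b)"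
      using c(1) d(1) smult B(2)
      by (intro V.V.finsum_cong')
        (auto simp: Pi_iff ring_hom_add[OF scalar_elem_ring_hom] V.smult_l_distr subset_iff
          scalar_elem_closed)
    also have "\<dots> = ?L c \<oplus>\<^bsub>V\<^esub> ?L d"
      using c(1) d(1) smult by (intro V.V.finsum_addf) auto
    finally show ?case
      using add(1,2) c d v by (intro bexI[of _ "\<lambda>b. c b \<oplus>\<^bsub>k\<^esub> d b"]) (auto simp: V.smult_l_distr)
  qed
  then have "\<forall>x\<in>carrier V. \<exists>c\<in>B \<rightarrow> carrier k. x = ?L c"
    by (auto dest: gen)
  with B V show ?thesis unfolding fd_module_def by (intro conjI exI[of _ B])
qed

section \<open>Units and idempotents\<close>

text \<open>Left multiplication by x is surjective, because x (y z) = z, hence injective on the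
  finite carrier. Since x (y x) = x = x 1, it follows that y x = 1.\<close>

lemma (in monoid) finite_left_inverse:
  assumes fin: "finite (carrier G)" and xy: "x \<in> carrier G" "y \<in> carrier G" "x \<otimes> y = \<one>"
  shows "y \<otimes> x = \<one>"
proof -
  have "(\<otimes>) x ` carrier G = carrier G"
  proof
    show "carrier G \<subseteq> (\<otimes>) x ` carrier G"
    proof
      fix z assume "z \<in> carrier G"
      with xy show "z \<in> (\<otimes>) x ` carrier G"
        by (intro image_eqI[of _ _ "y \<otimes> z"]) (simp_all flip: m_assoc)
    qed
  qed (use xy in auto)
  then have inj: "inj_on ((\<otimes>) x) (carrier G)"
    using fin by (simp add: eq_card_imp_inj_on)
  have "x \<otimes> (y \<otimes> x) = x \<otimes> \<one>" using xy by (simp flip: m_assoc)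
  then show ?thesis using inj_onD[OF inj] xy by simp
qed

text \<open>If u inverts x y, then y u is a right inverse of x and u x a left inverse of y; in a
  finite monoid one-sided inverses are two-sided.\<close>

lemma (in monoid) finite_Units_mult_iff:
  assumes fin: "finite (carrier G)" and x: "x \<in> carrier G" and y: "y \<in> carrier G"
  shows "x \<otimes> y \<in> Units G \<longleftrightarrow> x \<in> Units G \<and> y \<in> Units G"
proof
  assume u: "x \<otimes> y \<in> Units G"
  let ?u = "inv (x \<otimes> y)"
  have units: "z \<in> Units G \<and> w \<in> Units G" if "z \<in> carrier G" "w \<in> carrier G" "z \<otimes> w = \<one>" for z w
    using that finite_left_inverse[OF fin that] unfolding Units_def by blast
  have "x \<otimes> (y \<otimes> ?u) = \<one>" "(?u \<otimes> x) \<otimes> y = \<one>"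
    using x y u Units_inv_closed[OF u]
    by (simp_all add: m_assoc[symmetric, of x y] m_assoc[of ?u x y])
  moreover have "y \<otimes> ?u \<in> carrier G" "?u \<otimes> x \<in> carrier G"
    using x y u by auto
  ultimately show "x \<in> Units G \<and> y \<in> Units G"
    using x y units by metis
qed auto

section \<open>Commuting idempotents in an inverse monoid\<close>

context inverse_monoid
begin

lemma inverse_unique:
  assumes "x \<in> carrier M" "y \<in> carrier M" "z \<in> carrier M"
    and "x \<otimes> y \<otimes> x = x" "y \<otimes> x \<otimes> y = y" "x \<otimes> z \<otimes> x = x" "z \<otimes> x \<otimes> z = z"
  shows "y = z"
  using ex1_inverse[OF assms(1)] assms(2-7) by metis

text \<open>With x the inverse of e f, the element f x e is an inverse of e f as well, so x = f x e.
  This makes x idempotent, hence an inverse of itself; but e f is also an inverse of x, so e f =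
  x.\<close>

lemma idempotent_mult:
  assumes e: "e \<in> carrier M" "e \<otimes> e = e" and f: "f \<in> carrier M" "f \<otimes> f = f"
  shows "(e \<otimes> f) \<otimes> (e \<otimes> f) = e \<otimes> f"
proof -
  have ef: "e \<otimes> f \<in> carrier M" using e f by simp
  obtain x where x: "x \<in> carrier M" "(e \<otimes> f) \<otimes> x \<otimes> (e \<otimes> f) = e \<otimes> f" "x \<otimes> (e \<otimes> f) \<otimes> x = x"
    using ex1_inverse[OF ef] by blast
  note [simp] = e f x(1)
  have ee: "e \<otimes> (e \<otimes> z) = e \<otimes> z" and ff: "f \<otimes> (f \<otimes> z) = f \<otimes> z" if "z \<in> carrier M" for z
    using that by (simp_all flip: m_assoc)
  have 1: "e \<otimes> (f \<otimes> (x \<otimes> (e \<otimes> f))) = e \<otimes> f" using x(2) by (simp add: m_assoc)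
  have 2: "x \<otimes> (e \<otimes> (f \<otimes> x)) = x" using x(3) by (simp add: m_assoc)
  have 3: "x \<otimes> (e \<otimes> (f \<otimes> (x \<otimes> e))) = x \<otimes> e"
    using arg_cong[OF 2, of "\<lambda>z. z \<otimes> e"] by (simp add: m_assoc)
  have fxe: "f \<otimes> x \<otimes> e = x"
  proof (rule inverse_unique[of "e \<otimes> f"])
    show "e \<otimes> f \<otimes> (f \<otimes> x \<otimes> e) \<otimes> (e \<otimes> f) = e \<otimes> f" by (simp add: m_assoc ee ff 1)
    show "f \<otimes> x \<otimes> e \<otimes> (e \<otimes> f) \<otimes> (f \<otimes> x \<otimes> e) = f \<otimes> x \<otimes> e" by (simp add: m_assoc ee ff 3)
  qed (simp_all add: x(2,3))
  have xx: "x \<otimes> x = x"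
  proof -
    have "x \<otimes> x = f \<otimes> x \<otimes> e \<otimes> (f \<otimes> x \<otimes> e)" by (simp only: fxe)
    also have "\<dots> = f \<otimes> x \<otimes> e" by (simp add: m_assoc 3)
    finally show ?thesis by (simp only: fxe)
  qed
  have "e \<otimes> f = x"
    by (rule inverse_unique[of x]) (simp_all add: x(2,3) xx)
  with xx show ?thesis by simp
qed

text \<open>As products of idempotents are idempotent, both e f and f e are inverses of e f.\<close>

lemma idempotents_commute:
  assumes e: "e \<in> carrier M" "e \<otimes> e = e" and f: "f \<in> carrier M" "f \<otimes> f = f"
  shows "e \<otimes> f = f \<otimes> e"
proof (rule inverse_unique[of "e \<otimes> f"])
  note [simp] = e f
  have ee: "e \<otimes> (e \<otimes> z) = e \<otimes> z" and ff: "f \<otimes> (f \<otimes> z) = f \<otimes> z" if "z \<in> carrier M" for z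
    using that by (simp_all flip: m_assoc)
  have ef: "e \<otimes> (f \<otimes> (e \<otimes> f)) = e \<otimes> f" and fe: "f \<otimes> (e \<otimes> (f \<otimes> e)) = f \<otimes> e"
    using idempotent_mult[OF e f] idempotent_mult[OF f e] by (simp_all add: m_assoc)
  show "e \<otimes> f \<otimes> (e \<otimes> f) \<otimes> (e \<otimes> f) = e \<otimes> f" "e \<otimes> f \<otimes> (e \<otimes> f) \<otimes> (e \<otimes> f) = e \<otimes> f"
    using idempotent_mult[OF e f] by simp_all
  show "e \<otimes> f \<otimes> (f \<otimes> e) \<otimes> (e \<otimes> f) = e \<otimes> f" by (simp add: m_assoc ee ff ef)
  show "f \<otimes> e \<otimes> (e \<otimes> f) \<otimes> (f \<otimes> e) = f \<otimes> e" by (simp add: m_assoc ee ff fe)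
qed (use e f in simp_all)

text \<open>The factor is e = m n with n the inverse of m. It is a nonunit because in a finite
  monoid a product with a nonunit factor is one.\<close>

lemma nonunit_idempotent_factor:
  assumes fin: "finite (carrier M)" and m: "m \<in> carrier M" "m \<notin> Units M"
  obtains e where "e \<in> carrier M" "e \<otimes> e = e" "e \<notin> Units M" "e \<otimes> m = m"
proof -
  obtain n where n: "n \<in> carrier M" "m \<otimes> n \<otimes> m = m" "n \<otimes> m \<otimes> n = n"
    using ex1_inverse[OF m(1)] by blast
  have "m \<otimes> n \<notin> Units M" using m n(1) by (simp add: finite_Units_mult_iff[OF fin])
  moreover have "m \<otimes> n \<otimes> (m \<otimes> n) = m \<otimes> n" using m n by (simp flip: m_assoc)
  ultimately show ?thesis using that[of "m \<otimes> n"] m n by simp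
qed

end

section \<open>Restriction to the units as a homomorphism from kM to kG\<close>

definition unit_part :: "('m, 'd) monoid_scheme \<Rightarrow> ('m \<Rightarrow> 'k) \<Rightarrow> 'm \<Rightarrow> 'k" where
  "unit_part M a = restrict a (Units M)"

lemma ind_module_smult: "a \<odot>\<^bsub>ind_module M W\<^esub> w = unit_part M a \<odot>\<^bsub>W\<^esub> w"
  by (simp add: ind_module_def unit_part_def)

lemma ind_module_simps [simp]:
  "carrier (ind_module M W) = carrier W"
  "\<zero>\<^bsub>ind_module M W\<^esub> = \<zero>\<^bsub>W\<^esub>"
  "x \<oplus>\<^bsub>ind_module M W\<^esub> y = x \<oplus>\<^bsub>W\<^esub> y"
  "finsum (ind_module M W) f S = finsum W f S"
  by (simp_all add: ind_module_def finsum_def finprod_def)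

context finite_monoid_algebra
begin

abbreviation "kG \<equiv> monoid_algebra k (units_of M)"

lemma group_units: "group (units_of M)"
  by (rule M.units_group)

lemma finite_monoid_algebra_units: "finite_monoid_algebra k (units_of M)"
proof -
  interpret G: group "units_of M" by (rule group_units)
  have "finite (Units M)" using finite_carrier by (auto simp: Units_def)
  then show ?thesis
    by unfold_locales (simp add: units_of_carrier)
qed

interpretation G: finite_monoid_algebra k "units_of M"
  by (rule finite_monoid_algebra_units)

lemma unit_part_closed: "a \<in> carrier kM \<Longrightarrow> unit_part M a \<in> carrier kG"
  using M.Units_closed by (auto simp: unit_part_def monoid_algebra_carrier units_of_carrier)

lemma unit_part_add:
  "unit_part M (a \<oplus>\<^bsub>kM\<^esub> b) = unit_part M a \<oplus>\<^bsub>kG\<^esub> unit_part M b"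
  using M.Units_closed by (auto simp: unit_part_def monoid_algebra_add units_of_carrier fun_eq_iff)

lemma unit_part_monomial:
  "unit_part M (monomial k M m c) =
     (if m \<in> Units M then monomial k (units_of M) m c else \<zero>\<^bsub>kG\<^esub>)"
  using M.Units_closed
  by (auto simp: unit_part_def monomial_def monoid_algebra_zero units_of_carrier fun_eq_iff)

lemma unit_part_scalar_elem:
  "unit_part M (scalar_elem k M c) = scalar_elem k (units_of M) c"
  by (simp add: scalar_elem_eq_monomial unit_part_monomial units_of_one)

lemma unit_part_one: "unit_part M \<one>\<^bsub>kM\<^esub> = \<one>\<^bsub>kG\<^esub>"
  by (simp add: monoid_algebra_one unit_part_monomial units_of_one)

text \<open>Restriction to the units is multiplicative because in a finite monoid a product is a unit
  only if both factors are.\<close>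

lemma unit_part_mult:
  assumes "a \<in> carrier kM" "b \<in> carrier kM"
  shows "unit_part M (a \<otimes>\<^bsub>kM\<^esub> b) = unit_part M a \<otimes>\<^bsub>kG\<^esub> unit_part M b"
  using assms(1)
proof (induction a rule: monoid_algebra_induct)
  case m: (monomial m c)
  show ?case
    using assms(2)
  proof (induction b rule: monoid_algebra_induct)
    case (monomial n d)
    with m show ?case
      by (auto simp: monomial_mult unit_part_monomial M.finite_Units_mult_iff[OF finite_carrier]
          G.monomial_mult units_of_carrier units_of_mult G.monomial_closed)
  next
    case (add a b)
    with m show ?case
      by (simp add: kM.r_distr G.kM.r_distr unit_part_add monomial_closed mult_closed
          unit_part_closed)
  qed
next
  case (add a b)
  with assms show ?case
    by (simp add: kM.l_distr G.kM.l_distr unit_part_add mult_closed unit_part_closed)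
qed

text \<open>The induced module is P pulled back along the unital ring homomorphism
  \<open>unit_part\<close>. Scalars of kM restrict to the same scalars of kG, so a spanning set of P
  still spans.\<close>

lemma fd_ind_module:
  assumes "fd_module k (units_of M) P"
  shows "fd_module k M (ind_module M P)"
proof -
  interpret P: left_module kG P using assms by (simp add: fd_module_def)
  have "abelian_group (ind_module M P)"
    by (rule abelian_groupI) (auto simp: P.V.a_ac intro: P.V.add.l_inv_ex)
  then have "left_module kM (ind_module M P)"
    by (intro left_module.intro left_module_axioms.intro kM.ring_axioms)
      (simp_all add: ind_module_smult unit_part_closed unit_part_add unit_part_mult
        unit_part_one P.smult_closed P.smult_l_distr P.smult_r_distr P.smult_assoc
        P.smult_one)
  with assms show ?thesis
    by (simp add: fd_module_def ind_module_smult unit_part_scalar_elem)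
qed

end

section \<open>An element of kM that annihilates the nonunits\<close>

locale finite_inverse_monoid_algebra = finite_monoid_algebra k M + inverse_monoid M
  for k :: "('k, 'c) ring_scheme" and M :: "('m, 'd) monoid_scheme"
begin

interpretation G: finite_monoid_algebra k "units_of M"
  by (rule finite_monoid_algebra_units)

text \<open>The witness is the product of all \<open>1 - e\<close>, where \<open>e\<close> is an idempotent other than \<open>1\<close>.\<close>

lemma ex_nonunit_annihilator:
  obtains \<eta> where "\<eta> \<in> carrier kM" "unit_part M \<eta> = \<one>\<^bsub>kG\<^esub>"
    "\<And>m c. \<lbrakk>m \<in> carrier M; m \<notin> Units M; c \<in> carrier k\<rbrakk> \<Longrightarrow> \<eta> \<otimes>\<^bsub>kM\<^esub> monomial k M m c = \<zero>\<^bsub>kM\<^esub>"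
proof -
  let ?\<delta> = "\<lambda>m. monomial k M m \<one>\<^bsub>k\<^esub>"
  \<comment> \<open>The only idempotent unit is 1, so excluding the units amounts to excluding
    1.\<close>
  define E where "E = {e \<in> carrier M. e \<otimes>\<^bsub>M\<^esub> e = e \<and> e \<notin> Units M}"
  have "\<exists>\<eta>\<in>carrier kM. unit_part M \<eta> = \<one>\<^bsub>kG\<^esub> \<and> (\<forall>f\<in>F. \<eta> \<otimes>\<^bsub>kM\<^esub> ?\<delta> f = \<zero>\<^bsub>kM\<^esub>)"
    if "finite F" "F \<subseteq> E" for F
    using that
  proof (induction F rule: finite_induct)
    case empty
    then show ?case using unit_part_one by (intro bexI[of _ "\<one>\<^bsub>kM\<^esub>"]) auto
  next
    case (insert e F)
    then obtain \<eta> where \<eta>: "\<eta> \<in> carrier kM" "unit_part M \<eta> = \<one>\<^bsub>kG\<^esub>"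
      "\<forall>f\<in>F. \<eta> \<otimes>\<^bsub>kM\<^esub> ?\<delta> f = \<zero>\<^bsub>kM\<^esub>" by blast
    have e: "e \<in> carrier M" "e \<otimes>\<^bsub>M\<^esub> e = e" "e \<notin> Units M"
      using insert.prems by (auto simp: E_def)
    have \<delta>: "?\<delta> f \<in> carrier kM" for f by (simp add: monomial_closed)
    \<comment> \<open>The new factor 1 - e is put on the right. As e is a nonunit, this factor has
      unit part 1.\<close>
    define \<eta>' where "\<eta>' = \<eta> \<otimes>\<^bsub>kM\<^esub> (\<one>\<^bsub>kM\<^esub> \<oplus>\<^bsub>kM\<^esub> monomial k M e (\<ominus>\<^bsub>k\<^esub> \<one>\<^bsub>k\<^esub>))"
    have neg: "monomial k M e (\<ominus>\<^bsub>k\<^esub> \<one>\<^bsub>k\<^esub>) \<in> carrier kM" by (simp add: monomial_closed)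
    have "unit_part M \<eta>' = \<one>\<^bsub>kG\<^esub>"
      using \<eta> e neg
      by (simp add: \<eta>'_def unit_part_mult unit_part_add unit_part_one
          unit_part_monomial)
    moreover have "\<eta>' \<otimes>\<^bsub>kM\<^esub> ?\<delta> f = \<zero>\<^bsub>kM\<^esub>" if f: "f \<in> insert e F" for f
    proof -
      have f': "f \<in> carrier M" "f \<otimes>\<^bsub>M\<^esub> f = f" using f insert.prems by (auto simp: E_def)
      have "\<eta>' \<otimes>\<^bsub>kM\<^esub> ?\<delta> f = \<eta> \<otimes>\<^bsub>kM\<^esub> (?\<delta> f \<oplus>\<^bsub>kM\<^esub> monomial k M (e \<otimes>\<^bsub>M\<^esub> f) (\<ominus>\<^bsub>k\<^esub> \<one>\<^bsub>k\<^esub>))"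
        using \<eta> neg \<delta> e f'
        by (simp add: \<eta>'_def kM.m_assoc kM.l_distr monomial_mult)
      also have "\<dots> = \<zero>\<^bsub>kM\<^esub>"
      \<comment> \<open>For f = e the factor in brackets is e - e e = 0. Otherwise e f = f e turns f
        - e f into f (1 - e), and \<eta> already annihilates f.\<close>
      proof (cases "f = e")
        case True
        then show ?thesis
          using \<eta> e by (simp add: monomial_add k.r_neg monomial_zero)
      next
        case False
        then have "\<eta> \<otimes>\<^bsub>kM\<^esub> ?\<delta> f = \<zero>\<^bsub>kM\<^esub>" using f \<eta> by blast
        moreover have "monomial k M (e \<otimes>\<^bsub>M\<^esub> f) (\<ominus>\<^bsub>k\<^esub> \<one>\<^bsub>k\<^esub>) = ?\<delta> f \<otimes>\<^bsub>kM\<^esub> monomial k M e (\<ominus>\<^bsub>k\<^esub> \<one>\<^bsub>k\<^esub>)"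
          using e f' idempotents_commute[of e f] by (simp add: monomial_mult)
        ultimately show ?thesis
          using \<eta> \<delta> neg by (simp add: kM.r_distr flip: kM.m_assoc)
      qed
      finally show ?thesis .
    qed
    moreover have "\<eta>' \<in> carrier kM" using \<eta> neg by (simp add: \<eta>'_def)
    ultimately show ?case by blast
  qed
  from this[OF _ order.refl] obtain \<eta> where \<eta>: "\<eta> \<in> carrier kM" "unit_part M \<eta> = \<one>\<^bsub>kG\<^esub>"
      "\<forall>e\<in>E. \<eta> \<otimes>\<^bsub>kM\<^esub> ?\<delta> e = \<zero>\<^bsub>kM\<^esub>"
    using finite_carrier by (auto simp: E_def)
  show ?thesis
  proof (rule that[OF \<eta>(1,2)])
    fix m c assume m: "m \<in> carrier M" "m \<notin> Units M" and c: "c \<in> carrier k"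
    obtain e where e: "e \<in> E" "e \<otimes>\<^bsub>M\<^esub> m = m"
      using nonunit_idempotent_factor[OF finite_carrier m] by (auto simp: E_def)
    then have "e \<in> carrier M" by (simp add: E_def)
    then have "monomial k M m c = ?\<delta> e \<otimes>\<^bsub>kM\<^esub> monomial k M m c"
      using e(2) m c by (simp add: monomial_mult)
    then have "\<eta> \<otimes>\<^bsub>kM\<^esub> monomial k M m c = (\<eta> \<otimes>\<^bsub>kM\<^esub> ?\<delta> e) \<otimes>\<^bsub>kM\<^esub> monomial k M m c"
      using \<eta>(1) c by (simp add: kM.m_assoc monomial_closed)
    with \<eta>(3) e(1) c show "\<eta> \<otimes>\<^bsub>kM\<^esub> monomial k M m c = \<zero>\<^bsub>kM\<^esub>" by (simp add: monomial_closed)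
  qed
qed

end

section \<open>Left ideals generated by idempotents\<close>

lemma (in left_module) submoduleD:
  assumes "submodule U R V"
  shows "U \<subseteq> carrier V" "\<zero>\<^bsub>V\<^esub> \<in> U"
    "\<And>x y. \<lbrakk>x \<in> U; y \<in> U\<rbrakk> \<Longrightarrow> x \<oplus>\<^bsub>V\<^esub> y \<in> U"
    "\<And>x y. \<lbrakk>x \<in> U; y \<in> U\<rbrakk> \<Longrightarrow> x \<ominus>\<^bsub>V\<^esub> y \<in> U"
    "\<And>a x. \<lbrakk>a \<in> carrier R; x \<in> U\<rbrakk> \<Longrightarrow> a \<odot>\<^bsub>V\<^esub> x \<in> U"
proof -
  interpret U: submodule U R V by fact
  show "U \<subseteq> carrier V" "\<zero>\<^bsub>V\<^esub> \<in> U"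
    "\<And>x y. \<lbrakk>x \<in> U; y \<in> U\<rbrakk> \<Longrightarrow> x \<oplus>\<^bsub>V\<^esub> y \<in> U"
    "\<And>a x. \<lbrakk>a \<in> carrier R; x \<in> U\<rbrakk> \<Longrightarrow> a \<odot>\<^bsub>V\<^esub> x \<in> U"
    using U.subset U.one_closed U.m_closed by auto
  then show "\<And>x y. \<lbrakk>x \<in> U; y \<in> U\<rbrakk> \<Longrightarrow> x \<ominus>\<^bsub>V\<^esub> y \<in> U"
    using U.m_inv_closed by (simp add: a_minus_def a_inv_def)
qed

lemma (in left_module) submoduleI:
  assumes "U \<subseteq> carrier V" "\<zero>\<^bsub>V\<^esub> \<in> U"
    "\<And>x y. \<lbrakk>x \<in> U; y \<in> U\<rbrakk> \<Longrightarrow> x \<oplus>\<^bsub>V\<^esub> y \<in> U"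
    "\<And>x. x \<in> U \<Longrightarrow> \<ominus>\<^bsub>V\<^esub> x \<in> U"
    "\<And>a x. \<lbrakk>a \<in> carrier R; x \<in> U\<rbrakk> \<Longrightarrow> a \<odot>\<^bsub>V\<^esub> x \<in> U"
  shows "submodule U R V"
  using assms by (intro submodule.intro subgroup.intro submodule_axioms.intro) (auto simp: a_inv_def)

lemma submodule_vimage:
  assumes V: "left_module R V" and W: "left_module R W" and f: "f \<in> left_module_hom R V W"
    and U: "submodule U R W"
  shows "submodule {x \<in> carrier V. f x \<in> U} R V"
proof -
  interpret V: left_module R V by fact
  interpret W: left_module R W by fact
  note U' = W.submoduleD[OF U]
  have add: "f (x \<oplus>\<^bsub>V\<^esub> y) = f x \<oplus>\<^bsub>W\<^esub> f y" if "x \<in> carrier V" "y \<in> carrier V" for x y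
    using f that by (simp add: left_module_hom_def)
  have closed: "f x \<in> carrier W" if "x \<in> carrier V" for x
    using f that by (auto simp: left_module_hom_def)
  have zero: "f \<zero>\<^bsub>V\<^esub> = \<zero>\<^bsub>W\<^esub>" by (rule left_module_hom_zero[OF V W f])
  have neg: "f (\<ominus>\<^bsub>V\<^esub> x) = \<zero>\<^bsub>W\<^esub> \<ominus>\<^bsub>W\<^esub> f x" if x: "x \<in> carrier V" for x
  proof -
    have "f x \<oplus>\<^bsub>W\<^esub> f (\<ominus>\<^bsub>V\<^esub> x) = \<zero>\<^bsub>W\<^esub>"
      using add[of x "\<ominus>\<^bsub>V\<^esub> x"] x zero by (simp add: V.V.r_neg)
    then have "\<ominus>\<^bsub>W\<^esub> f x = f (\<ominus>\<^bsub>V\<^esub> x)"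
      using x by (intro W.V.minus_equality) (simp_all add: closed W.V.a_comm)
    then show ?thesis using x closed by (simp add: a_minus_def)
  qed
  show ?thesis
    using f U'(2-5) by (intro V.submoduleI)
      (auto simp: add neg zero left_module_hom_def V.smult_closed)
qed

text \<open>Any decomposition of W pulls back along the isomorphism to one of V. This carries
  indecomposability from kG e to its copy with carrier in \<open>nat \<Rightarrow> 'k\<close>, as
  \<open>group_injective\<close> demands.\<close>

lemma indecomposable_module_iso:
  assumes V: "left_module R V" and W: "left_module R W" and f: "f \<in> left_module_hom R V W"
    and bij: "bij_betw f (carrier V) (carrier W)"
    and ind: "indecomposable_module R V"
  shows "indecomposable_module R W"
proof -
  interpret V: left_module R V by fact
  interpret W: left_module R W by fact
  have zero: "f \<zero>\<^bsub>V\<^esub> = \<zero>\<^bsub>W\<^esub>" by (rule left_module_hom_zero[OF V W f])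
  have inj: "inj_on f (carrier V)" and img: "f ` carrier V = carrier W"
    using bij by (auto simp: bij_betw_def)
  \<comment> \<open>A submodule of W lies in the image of its preimage, because f is onto.\<close>
  have trivial: "S = {\<zero>\<^bsub>W\<^esub>}" if "submodule S R W" "{x \<in> carrier V. f x \<in> S} = {\<zero>\<^bsub>V\<^esub>}" for S
  proof -
    have "S \<subseteq> f ` {x \<in> carrier V. f x \<in> S}"
      using W.submoduleD(1)[OF that(1)] unfolding img[symmetric] by auto
    then show ?thesis using that(2) zero W.submoduleD(2)[OF that(1)] by auto
  qed
  have "carrier W \<noteq> {\<zero>\<^bsub>W\<^esub>}"
  proof
    assume "carrier W = {\<zero>\<^bsub>W\<^esub>}"
    then have "\<forall>x\<in>carrier V. f x = f \<zero>\<^bsub>V\<^esub>" using img zero by auto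
    then have "carrier V = {\<zero>\<^bsub>V\<^esub>}" using inj V.V.zero_closed by (auto dest: inj_onD)
    then show False using ind by (simp add: indecomposable_module_def)
  qed
  moreover have "S = {\<zero>\<^bsub>W\<^esub>} \<or> T = {\<zero>\<^bsub>W\<^esub>}"
    if S: "submodule S R W" and T: "submodule T R W" and sum: "S <+>\<^bsub>W\<^esub> T = carrier W"
      and int: "S \<inter> T = {\<zero>\<^bsub>W\<^esub>}" for S T
  proof -
    let ?v = "\<lambda>U. {x \<in> carrier V. f x \<in> U}"
    have "?v S <+>\<^bsub>V\<^esub> ?v T = carrier V"
    proof
      show "carrier V \<subseteq> ?v S <+>\<^bsub>V\<^esub> ?v T"
      proof
        fix v assume v: "v \<in> carrier V"
        then have "f v \<in> S <+>\<^bsub>W\<^esub> T" unfolding sum using img by blast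
        then obtain x y where xy: "x \<in> S" "y \<in> T" "f v = x \<oplus>\<^bsub>W\<^esub> y"
          by (auto simp: set_add_def')
        then have "x \<in> f ` carrier V" "y \<in> f ` carrier V"
          using W.submoduleD(1)[OF S] W.submoduleD(1)[OF T] unfolding img by auto
        then obtain a b where ab: "a \<in> carrier V" "x = f a" "b \<in> carrier V" "y = f b"
          by (elim imageE)
        then have "f v = f (a \<oplus>\<^bsub>V\<^esub> b)" using xy f by (simp add: left_module_hom_def)
        then have "v = a \<oplus>\<^bsub>V\<^esub> b" using inj_onD[OF inj] v ab by simp
        then show "v \<in> ?v S <+>\<^bsub>V\<^esub> ?v T" using ab xy by (auto simp: set_add_def')
      qed
    qed (auto simp: set_add_def')
    moreover have "?v S \<inter> ?v T = {\<zero>\<^bsub>V\<^esub>}"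
    proof -
      have "x = \<zero>\<^bsub>V\<^esub>" if "x \<in> carrier V" "f x \<in> S" "f x \<in> T" for x
      proof -
        have "f x = f \<zero>\<^bsub>V\<^esub>" using that int zero by auto
        then show ?thesis using inj_onD[OF inj] that by simp
      qed
      then show ?thesis using W.submoduleD(2)[OF S] W.submoduleD(2)[OF T] zero by auto
    qed
    ultimately have "?v S = {\<zero>\<^bsub>V\<^esub>} \<or> ?v T = {\<zero>\<^bsub>V\<^esub>}"
      using ind submodule_vimage[OF V W f S] submodule_vimage[OF V W f T]
      unfolding indecomposable_module_def by blast
    then show ?thesis using trivial S T by blast
  qed
  ultimately show ?thesis unfolding indecomposable_module_def by blast
qed

text \<open>For an idempotent \<open>e\<close>, this is the left ideal generated by \<open>e\<close>.\<close>

definition left_ideal_module :: "('r, 'c) ring_scheme \<Rightarrow> 'r \<Rightarrow> ('r, 'r) module" where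
  "left_ideal_module R e = \<lparr>carrier = {x \<in> carrier R. x \<otimes>\<^bsub>R\<^esub> e = x}, monoid.mult = monoid.mult R,
     monoid.one = monoid.one R, ring.zero = \<zero>\<^bsub>R\<^esub>, ring.add = ring.add R,
     smult = monoid.mult R\<rparr>"

lemma left_ideal_module_simps [simp]:
  "carrier (left_ideal_module R e) = {x \<in> carrier R. x \<otimes>\<^bsub>R\<^esub> e = x}"
  "\<zero>\<^bsub>left_ideal_module R e\<^esub> = \<zero>\<^bsub>R\<^esub>"
  "x \<oplus>\<^bsub>left_ideal_module R e\<^esub> y = x \<oplus>\<^bsub>R\<^esub> y"
  "a \<odot>\<^bsub>left_ideal_module R e\<^esub> x = a \<otimes>\<^bsub>R\<^esub> x"
  by (simp_all add: left_ideal_module_def)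

context ring
begin

lemma left_module_left_ideal:
  assumes "e \<in> carrier R"
  shows "left_module R (left_ideal_module R e)"
proof -
  have "abelian_group (left_ideal_module R e)"
  proof (rule abelian_groupI)
    fix x assume "x \<in> carrier (left_ideal_module R e)"
    then show "\<exists>y\<in>carrier (left_ideal_module R e).
        y \<oplus>\<^bsub>left_ideal_module R e\<^esub> x = \<zero>\<^bsub>left_ideal_module R e\<^esub>"
      using assms by (intro bexI[of _ "\<ominus> x"]) (auto simp: l_minus l_neg)
  qed (use assms in \<open>auto simp: l_distr a_ac\<close>)
  then show ?thesis
    using assms
    by (intro left_module.intro left_module_axioms.intro ring_axioms)
      (auto simp: l_distr r_distr m_assoc)
qed

text \<open>Negation in a structure is described relative to its carrier, so the difference in the
  left ideal has to be identified with the one in R.\<close>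

lemma left_ideal_module_minus:
  assumes "e \<in> carrier R" "x \<in> carrier (left_ideal_module R e)" "y \<in> carrier (left_ideal_module R e)"
  shows "x \<ominus>\<^bsub>left_ideal_module R e\<^esub> y = x \<ominus> y"
proof -
  interpret E: left_module R "left_ideal_module R e" by (rule left_module_left_ideal) fact
  have "\<ominus>\<^bsub>left_ideal_module R e\<^esub> y = \<ominus> y"
    using assms by (intro E.V.minus_equality) (auto simp: l_minus l_neg)
  then show ?thesis by (simp add: a_minus_def)
qed

text \<open>A decomposition of \<open>Re\<close> splits \<open>e\<close> into orthogonal idempotents which generate the summands.\<close>

lemma indecomposable_left_ideal_module:
  assumes e: "e \<in> carrier R" "e \<otimes> e = e" "e \<noteq> \<zero>"
    and minimal: "\<And>f. \<lbrakk>f \<in> carrier R; f \<otimes> f = f; f \<noteq> \<zero>;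
        carrier (left_ideal_module R f) \<subseteq> carrier (left_ideal_module R e)\<rbrakk> \<Longrightarrow>
      carrier (left_ideal_module R f) = carrier (left_ideal_module R e)"
  shows "indecomposable_module R (left_ideal_module R e)"
proof -
  let ?E = "left_ideal_module R e"
  interpret E: left_module R ?E by (rule left_module_left_ideal) fact
  have "U = {\<zero>} \<or> W = {\<zero>}"
    if U: "submodule U R ?E" and W: "submodule W R ?E" and sum: "U <+>\<^bsub>?E\<^esub> W = carrier ?E"
      and int: "U \<inter> W = {\<zero>}" for U W
  proof -
    note UD = E.submoduleD[OF U] and WD = E.submoduleD[OF W]
    have R: "x \<in> carrier R" "x \<otimes> e = x" if "x \<in> U \<or> x \<in> W" for x
      using that UD(1) WD(1) by auto
    have "e \<in> U <+>\<^bsub>?E\<^esub> W" using sum e by simp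
    then obtain u w where u: "u \<in> U" and w: "w \<in> W" and uw: "e = u \<oplus> w"
      by (auto simp: set_add_def')
    \<comment> \<open>Expanding x = x e with e = u + w gives x w = x - x u, which lies in both U and
      W and so is zero.\<close>
    have xu: "x \<otimes> u = x" if x: "x \<in> U" for x
    proof -
      have "x = x \<otimes> u \<oplus> x \<otimes> w"
        using R[of x] R[of u] R[of w] x u w uw by (metis r_distr)
      moreover have "x \<otimes> u \<in> U" "x \<otimes> w \<in> W"
        using UD(5)[of x u] WD(5)[of x w] u w x R by auto
      ultimately have eq: "x \<otimes> w = x \<ominus> x \<otimes> u" "x \<otimes> u \<in> U" "x \<otimes> w \<in> W"
        using R x by (metis R minus_eq a_comm a_inv_closed add.inv_solve_right)+
      have "x \<in> carrier ?E" "x \<otimes> u \<in> carrier ?E"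
        using UD(1) x eq(2) by blast+
      from left_ideal_module_minus[OF e(1) this] have "x \<ominus> x \<otimes> u \<in> U"
        using UD(4)[OF x eq(2)] by (simp only:)
      then have "x \<otimes> w \<in> U \<inter> W" using eq by simp
      then have "x \<otimes> w = \<zero>" using int by blast
      then show ?thesis using \<open>x = x \<otimes> u \<oplus> x \<otimes> w\<close> R x u by simp
    qed
    \<comment> \<open>Since x u = x on U, the summand U is the left ideal of the idempotent u, which
      is where minimality applies.\<close>
    have Ru: "carrier (left_ideal_module R u) = U"
    proof -
      have "x \<in> U" if "x \<in> carrier R" "x \<otimes> u = x" for x
        using UD(5)[of x u] that u by simp
      then show ?thesis using xu R by auto
    qed
    show ?thesis
    \<comment> \<open>If u = 0, every x = x u in U is zero. If u is nonzero, minimality makes U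
      everything, so W lies in U and is zero.\<close>
    proof (cases "u = \<zero>")
      case True
      then have "x = \<zero>" if "x \<in> U" for x using xu[OF that] R[of x] that by simp
      moreover have "\<zero> \<in> U" using UD(2) by simp
      ultimately show ?thesis by blast
    next
      case False
      then have "U = carrier ?E"
        using minimal[of u] Ru UD(1) xu[OF u] R u by blast
      then have "W \<subseteq> U" using WD(1) by simp
      then show ?thesis using int by blast
    qed
  qed
  moreover have "e \<in> carrier ?E" using e by simp
  ultimately show ?thesis using e(3) unfolding indecomposable_module_def by auto
qed

text \<open>A basis of V is independent in E and has as many members as the dimension of E, so it
  spans E.\<close>

lemma dim_eq_imp_eq:
  assumes K: "subfield K R" and E: "finite_dimension K E" and V: "subalgebra K V R" "V \<subseteq> E"
    and dim: "(dim over K) E \<le> (dim over K) V"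
  shows "V = E"
proof -
  have finV: "finite_dimension K V"
    by (rule subalbegra_incl_imp_finite_dimension[OF K E V])
  obtain Us where Us: "set Us \<subseteq> carrier R" "independent K Us" "length Us = (dim over K) V"
      "Span K Us = V"
    using exists_base[OF K finite_dimensionE[OF K finV]] by blast
  have "set Us \<subseteq> E" using Span_base_incl[OF K Us(1)] Us(4) V(2) by blast
  with Us dim independent_length_le_dimension[OF K finite_dimensionE[OF K E]]
    independent_length_eq_dimension[OF K finite_dimensionE[OF K E]]
  show ?thesis by (metis order.antisym)
qed

end

section \<open>A minimal idempotent and its projective left ideal\<close>

context finite_monoid_algebra
begin

lemma one_neq_zero: "\<one>\<^bsub>kM\<^esub> \<noteq> \<zero>\<^bsub>kM\<^esub>"
proof
  assume "\<one>\<^bsub>kM\<^esub> = \<zero>\<^bsub>kM\<^esub>"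
  then have "\<one>\<^bsub>kM\<^esub> \<one>\<^bsub>M\<^esub> = \<zero>\<^bsub>kM\<^esub> \<one>\<^bsub>M\<^esub>" by simp
  then show False by (simp add: monoid_algebra_one monoid_algebra_zero monomial_def)
qed

text \<open>The image of a field under a ring homomorphism is a field once 1 and 0 differ in the
  target. Dimensions of left ideals of kM are taken over this copy of k.\<close>

lemma subfield_scalars: "subfield (scalar_elem k M ` carrier k) kM"
proof -
  interpret h: ring_hom_ring k kM "scalar_elem k M"
    using scalar_elem_ring_hom by unfold_locales
  show ?thesis by (rule h.img_is_subfield(2)[OF k.carrier_is_subfield one_neq_zero])
qed

lemma finite_dimension_carrier:
  "kM.finite_dimension (scalar_elem k M ` carrier k) (carrier kM)"
proof -
  let ?K = "scalar_elem k M ` carrier k"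
  obtain ms where ms: "set ms = carrier M" using finite_list[OF finite_carrier] by blast
  let ?Us = "map (\<lambda>m. monomial k M m \<one>\<^bsub>k\<^esub>) ms"
  have Us: "set ?Us \<subseteq> carrier kM" by (auto simp: monomial_closed)
  note Span = kM.Span_subgroup_props[OF subfield_scalars Us]
    kM.Span_smult_closed[OF subfield_scalars Us] kM.Span_base_incl[OF subfield_scalars Us]
  have "a \<in> kM.Span ?K ?Us" if "a \<in> carrier kM" for a
    using that
  proof (induction a rule: monoid_algebra_induct)
    case (monomial m c)
    then have "monomial k M m c = scalar_elem k M c \<otimes>\<^bsub>kM\<^esub> monomial k M m \<one>\<^bsub>k\<^esub>"
      by (simp add: scalar_mult_monomial)
    moreover have "monomial k M m \<one>\<^bsub>k\<^esub> \<in> set ?Us" using monomial ms by simp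
    ultimately show ?case using Span monomial(2) by (metis (no_types) imageI subsetD)
  next
    case (add a b)
    then show ?case using Span(3) by blast
  qed
  then have "kM.Span ?K ?Us = carrier kM" using Span(1) by blast
  then show ?thesis using kM.Span_finite_dimension[OF subfield_scalars Us] by simp
qed

text \<open>Among the nonzero idempotents, of which 1 is one, take e with left ideal of least
  dimension over k. The left ideal of a nonzero idempotent contained in it then has the same
  dimension and is equal to it, which is the minimality required for indecomposability.\<close>

lemma ex_indecomposable_left_ideal_module:
  obtains e where "e \<in> carrier kM" "e \<otimes>\<^bsub>kM\<^esub> e = e"
    "indecomposable_module kM (left_ideal_module kM e)"
proof -
  let ?K = "scalar_elem k M ` carrier k"
  let ?d = "\<lambda>e. kM.dim ?K (carrier (left_ideal_module kM e))"
  define I where "I e \<longleftrightarrow> e \<in> carrier kM \<and> e \<otimes>\<^bsub>kM\<^esub> e = e \<and> e \<noteq> \<zero>\<^bsub>kM\<^esub>" for e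
  have "I \<one>\<^bsub>kM\<^esub>" by (simp add: I_def one_neq_zero)
  then obtain e where e: "I e" "\<And>f. I f \<Longrightarrow> ?d e \<le> ?d f"
    using ex_has_least_nat[of I _ ?d] by blast
  have sub: "subalgebra ?K (carrier (left_ideal_module kM f)) kM" if "f \<in> carrier kM" for f
  proof (intro subalgebra.intro subalgebra_axioms.intro)
    show "subgroup (carrier (left_ideal_module kM f)) (add_monoid kM)"
      using that by (intro kM.add.subgroupI) (auto simp: kM.l_minus kM.l_distr a_inv_def[symmetric])
  qed (use that in \<open>auto simp: kM.m_assoc scalar_elem_closed\<close>)
  have fin: "kM.finite_dimension ?K (carrier (left_ideal_module kM f))" if "f \<in> carrier kM" for f
    using sub[OF that] by (intro kM.subalbegra_incl_imp_finite_dimension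
        [OF subfield_scalars finite_dimension_carrier]) auto
  show ?thesis
  proof (rule that)
    show "indecomposable_module kM (left_ideal_module kM e)"
    proof (rule kM.indecomposable_left_ideal_module)
      fix f assume f: "f \<in> carrier kM" "f \<otimes>\<^bsub>kM\<^esub> f = f" "f \<noteq> \<zero>\<^bsub>kM\<^esub>"
        "carrier (left_ideal_module kM f) \<subseteq> carrier (left_ideal_module kM e)"
      then show "carrier (left_ideal_module kM f) = carrier (left_ideal_module kM e)"
        using e sub[of f] fin[of e]
        by (intro kM.dim_eq_imp_eq[OF subfield_scalars]) (auto simp: I_def over_def)
    qed (use e in \<open>auto simp: I_def\<close>)
  qed (use e in \<open>auto simp: I_def\<close>)
qed

lemma fd_left_ideal_module:
  assumes e: "e \<in> carrier kM" "e \<otimes>\<^bsub>kM\<^esub> e = e"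
  shows "fd_module k M (left_ideal_module kM e)"
  using e by (intro fd_module_cyclic[OF kM.left_module_left_ideal[OF e(1)], of e]) (auto intro: sym)

text \<open>Choose a in A with f(a) = g(e) and lift by x \<mapsto> x a. This works because x = x e
  on the left ideal, so that f(x a) = x g(e) = g(x e) = g(x).\<close>

lemma left_ideal_module_lift:
  assumes e: "e \<in> carrier kM" "e \<otimes>\<^bsub>kM\<^esub> e = e"
    and A: "left_module kM A"
    and f: "f \<in> left_module_hom kM A B" "f ` carrier A = carrier B"
    and g: "g \<in> left_module_hom kM (left_ideal_module kM e) B"
  shows "\<exists>h \<in> left_module_hom kM (left_ideal_module kM e) A.
    \<forall>x\<in>carrier (left_ideal_module kM e). f (h x) = g x"
proof -
  interpret A: left_module kM A by fact
  have "g e \<in> carrier B" using g e by (auto simp: left_module_hom_def)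
  then obtain a where a: "a \<in> carrier A" "f a = g e" using f(2) by (metis imageE)
  have "f (x \<odot>\<^bsub>A\<^esub> a) = g x" if x: "x \<in> carrier kM" "x \<otimes>\<^bsub>kM\<^esub> e = x" for x
  proof -
    have "f (x \<odot>\<^bsub>A\<^esub> a) = x \<odot>\<^bsub>B\<^esub> g e" using f(1) a x by (simp add: left_module_hom_def)
    also have "\<dots> = g (x \<otimes>\<^bsub>kM\<^esub> e)" using g e x(1) by (simp add: left_module_hom_def)
    finally show ?thesis by (simp add: x)
  qed
  moreover have "(\<lambda>x. x \<odot>\<^bsub>A\<^esub> a) \<in> left_module_hom kM (left_ideal_module kM e) A"
    using a by (auto simp: left_module_hom_def A.smult_closed A.smult_l_distr A.smult_assoc)
  ultimately show ?thesis by (intro bexI[of _ "\<lambda>x. x \<odot>\<^bsub>A\<^esub> a"]) auto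
qed

end

section \<open>Injectivity of induced modules\<close>

context finite_monoid_algebra
begin

text \<open>Left multiplication by the unit m permutes M, so only the coefficient of a at m^{-1} x
  contributes to the one at x.\<close>

lemma coeff_monomial_unit_mult:
  assumes m: "m \<in> Units M" and c: "c \<in> carrier k" and a: "a \<in> carrier kM" and x: "x \<in> carrier M"
  shows "(monomial k M m c \<otimes>\<^bsub>kM\<^esub> a) x = c \<otimes>\<^bsub>k\<^esub> a (inv\<^bsub>M\<^esub> m \<otimes>\<^bsub>M\<^esub> x)"
  using a
proof (induction a rule: monoid_algebra_induct)
  case (monomial n d)
  have "x = m \<otimes>\<^bsub>M\<^esub> n \<longleftrightarrow> inv\<^bsub>M\<^esub> m \<otimes>\<^bsub>M\<^esub> x = n"
    using m x monomial M.Units_closed[OF m] M.Units_inv_closed[OF m]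
    by (auto simp: M.m_assoc[symmetric])
  with m c x monomial show ?case
    by (simp add: monomial_mult M.Units_closed) (simp add: monomial_def M.Units_closed)
next
  case (add a b)
  with m c x show ?case
    by (simp add: kM.r_distr monomial_closed)
      (simp add: monoid_algebra_add M.Units_closed coeff_closed k.r_distr)
qed

end

context finite_inverse_monoid_algebra
begin

interpretation G: finite_monoid_algebra k "units_of M"
  by (rule finite_monoid_algebra_units)

text \<open>A homomorphism into \<open>kG\<close> amounts to a linear functional, its coefficient at \<open>1\<close>, and linear
  functionals extend from a subspace. Precomposing with \<open>\<eta>\<close> makes the functional vanish on what
  the nonunits produce.\<close>

lemma ind_left_ideal_module_extend:
  assumes e: "e \<in> carrier kG" "e \<otimes>\<^bsub>kG\<^esub> e = e"
    and A: "left_module kM A" and B: "fd_module k M B"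
    and f: "f \<in> left_module_hom kM A B" "inj_on f (carrier A)"
    and g: "g \<in> left_module_hom kM A (ind_module M (left_ideal_module kG e))"
  shows "\<exists>h \<in> left_module_hom kM B (ind_module M (left_ideal_module kG e)).
    \<forall>x\<in>carrier A. h (f x) = g x"
proof -
  have LB: "left_module kM B" using B by (simp add: fd_module_def)
  interpret A: left_module kM A by fact
  interpret B: left_module kM B by fact
  interpret kB: module k "scalar_module k M B" by (rule module_scalar_module[OF LB])
  have f_closed: "f x \<in> carrier B" if "x \<in> carrier A" for x
    using f(1) that by (auto simp: left_module_hom_def)
  have f_add: "f (x \<oplus>\<^bsub>A\<^esub> y) = f x \<oplus>\<^bsub>B\<^esub> f y" if "x \<in> carrier A" "y \<in> carrier A" for x y
    using f(1) that by (simp add: left_module_hom_def)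
  have f_smult: "f (a \<odot>\<^bsub>A\<^esub> x) = a \<odot>\<^bsub>B\<^esub> f x" if "a \<in> carrier kM" "x \<in> carrier A" for a x
    using f(1) that by (simp add: left_module_hom_def)
  have g_closed: "g x \<in> carrier kG" "g x \<otimes>\<^bsub>kG\<^esub> e = g x" if "x \<in> carrier A" for x
    using g that by (auto simp: left_module_hom_def)
  have g_add: "g (x \<oplus>\<^bsub>A\<^esub> y) = g x \<oplus>\<^bsub>kG\<^esub> g y" if "x \<in> carrier A" "y \<in> carrier A" for x y
    using g that by (simp add: left_module_hom_def)
  have g_smult: "g (a \<odot>\<^bsub>A\<^esub> x) = unit_part M a \<otimes>\<^bsub>kG\<^esub> g x"
    if "a \<in> carrier kM" "x \<in> carrier A" for a x
    using g that by (simp add: left_module_hom_def ind_module_smult)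
  define fi where "fi = inv_into (carrier A) f"
  have fi: "fi (f x) = x" if "x \<in> carrier A" for x
    using that f(2) by (simp add: fi_def)
  have one: "\<one>\<^bsub>M\<^esub> \<in> carrier (units_of M)" by (simp add: units_of_carrier)
  \<comment> \<open>\<open>l\<close> is the coefficient of g at 1, carried over to the image of f.
    It determines g, since the coefficient of g(x) at u is that of u^{-1} g(x) at 1.\<close>
  define l where "l b = g (fi b) \<one>\<^bsub>M\<^esub>" for b
  have sub: "submodule (f ` carrier A) k (scalar_module k M B)"
  proof (rule kB.submoduleI)
    show "f ` carrier A \<subseteq> carrier (scalar_module k M B)" using f_closed by auto
    show "\<zero>\<^bsub>scalar_module k M B\<^esub> \<in> f ` carrier A"
      using left_module_hom_zero[OF A LB f(1)] A.V.zero_closed by (metis imageI scalar_module_simps(2))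
  next
    fix x y assume "x \<in> f ` carrier A" "y \<in> f ` carrier A"
    then show "x \<oplus>\<^bsub>scalar_module k M B\<^esub> y \<in> f ` carrier A"
      by (auto simp flip: f_add)
  next
    fix c x assume "c \<in> carrier k" "x \<in> f ` carrier A"
    then show "c \<odot>\<^bsub>scalar_module k M B\<^esub> x \<in> f ` carrier A"
      by (auto simp: scalar_elem_closed A.smult_closed simp flip: f_smult)
  next
    fix x assume "x \<in> f ` carrier A"
    then obtain a where a: "a \<in> carrier A" "x = f a" by blast
    have "\<ominus>\<^bsub>scalar_module k M B\<^esub> x = f (\<ominus>\<^bsub>A\<^esub> a)"
    proof (rule kB.M.minus_equality)
      show "f (\<ominus>\<^bsub>A\<^esub> a) \<oplus>\<^bsub>scalar_module k M B\<^esub> x = \<zero>\<^bsub>scalar_module k M B\<^esub>"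
        using a left_module_hom_zero[OF A LB f(1)] by (simp add: A.V.l_neg flip: f_add)
    qed (use a f_closed in auto)
    then show "\<ominus>\<^bsub>scalar_module k M B\<^esub> x \<in> f ` carrier A" using a by simp
  qed
  have l: "kB.linear_functional_on (f ` carrier A) l"
    unfolding kB.linear_functional_on_def
  proof (intro conjI ballI)
    show "l \<in> f ` carrier A \<rightarrow> carrier k"
      using one by (auto simp: l_def fi intro: G.coeff_closed[OF g_closed(1)])
  next
    fix x y assume "x \<in> f ` carrier A" "y \<in> f ` carrier A"
    then show "l (x \<oplus>\<^bsub>scalar_module k M B\<^esub> y) = l x \<oplus>\<^bsub>k\<^esub> l y"
      using one
      by (auto simp: l_def fi g_add simp flip: f_add) (simp add: monoid_algebra_add)
  next
    fix c x assume "c \<in> carrier k" "x \<in> f ` carrier A"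
    then show "l (c \<odot>\<^bsub>scalar_module k M B\<^esub> x) = c \<otimes>\<^bsub>k\<^esub> l x"
      using one g_closed
      by (auto simp: l_def fi g_smult scalar_elem_closed A.smult_closed unit_part_scalar_elem
          G.scalar_elem_mult_coeff simp flip: f_smult)
  qed
  obtain S where S: "finite S" "S \<subseteq> carrier (scalar_module k M B)"
    "\<forall>v\<in>carrier (scalar_module k M B). \<exists>c\<in>S \<rightarrow> carrier k.
      v = (\<Oplus>\<^bsub>scalar_module k M B\<^esub>b\<in>S. c b \<odot>\<^bsub>scalar_module k M B\<^esub> b)"
    using B unfolding fd_module_def by auto
  \<comment> \<open>\<mu> is only k-linear; compatibility with kM comes from the translates in
    \<open>h\<close>.\<close>
  obtain \<mu> where \<mu>: "kB.linear_functional_on (carrier (scalar_module k M B)) \<mu>"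
      and \<mu>l: "\<And>x. x \<in> f ` carrier A \<Longrightarrow> \<mu> x = l x"
    by (rule linear_functional_extend[OF k.field_axioms kB.module_axioms S sub l]) blast
  have \<mu>_closed: "\<mu> x \<in> carrier k" if "x \<in> carrier B" for x
    using \<mu> that by (auto simp: kB.linear_functional_on_def)
  have \<mu>_add: "\<mu> (x \<oplus>\<^bsub>B\<^esub> y) = \<mu> x \<oplus>\<^bsub>k\<^esub> \<mu> y" if "x \<in> carrier B" "y \<in> carrier B" for x y
    using \<mu> that by (simp add: kB.linear_functional_on_def)
  have \<mu>_smult: "\<mu> (scalar_elem k M c \<odot>\<^bsub>B\<^esub> x) = c \<otimes>\<^bsub>k\<^esub> \<mu> x"
    if "c \<in> carrier k" "x \<in> carrier B" for c x
    using \<mu> that by (simp add: kB.linear_functional_on_def)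
  have \<mu>_zero: "\<mu> \<zero>\<^bsub>B\<^esub> = \<zero>\<^bsub>k\<^esub>"
    using \<mu>_smult[of "\<zero>\<^bsub>k\<^esub>" "\<zero>\<^bsub>B\<^esub>"] \<mu>_closed[of "\<zero>\<^bsub>B\<^esub>"]
    by (simp add: scalar_elem_eq_monomial monomial_zero B.smult_l_null)
  obtain \<eta> where \<eta>: "\<eta> \<in> carrier kM" "unit_part M \<eta> = \<one>\<^bsub>kG\<^esub>"
    "\<And>m c. \<lbrakk>m \<in> carrier M; m \<notin> Units M; c \<in> carrier k\<rbrakk> \<Longrightarrow> \<eta> \<otimes>\<^bsub>kM\<^esub> monomial k M m c = \<zero>\<^bsub>kM\<^esub>"
    by (rule ex_nonunit_annihilator) blast
  \<comment> \<open>\<open>h b\<close> below is the sum of the \<mu>(\<eta> u^{-1} b) u over the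
    units u. The inverse turns left multiplication of b by a unit into left multiplication of the
    sum by it.\<close>
  define t where "t u = \<eta> \<otimes>\<^bsub>kM\<^esub> monomial k M (inv\<^bsub>M\<^esub> u) \<one>\<^bsub>k\<^esub>" for u
  have t: "t u \<in> carrier kM" for u using \<eta>(1) by (simp add: t_def monomial_closed)
  define h where "h b = (\<lambda>u\<in>Units M. \<mu> (t u \<odot>\<^bsub>B\<^esub> b))" for b
  have h_closed: "h b \<in> carrier kG" if "b \<in> carrier B" for b
    using that t \<mu>_closed B.smult_closed
    by (auto simp: h_def monoid_algebra_carrier units_of_carrier)
  have h_add: "h (b \<oplus>\<^bsub>B\<^esub> c) = h b \<oplus>\<^bsub>kG\<^esub> h c" if "b \<in> carrier B" "c \<in> carrier B" for b c
    using that t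
    by (auto simp: h_def monoid_algebra_add units_of_carrier fun_eq_iff B.smult_r_distr \<mu>_add
        B.smult_closed)
  have h_smult: "h (a \<odot>\<^bsub>B\<^esub> b) = unit_part M a \<otimes>\<^bsub>kG\<^esub> h b" if "a \<in> carrier kM" and b: "b \<in> carrier B"
    for a b
    using that(1)
  proof (induction a rule: monoid_algebra_induct)
    case (monomial m c)
    have tm: "t u \<otimes>\<^bsub>kM\<^esub> monomial k M m c = \<eta> \<otimes>\<^bsub>kM\<^esub> monomial k M (inv\<^bsub>M\<^esub> u \<otimes>\<^bsub>M\<^esub> m) c"
      if "u \<in> Units M" for u
      using that monomial \<eta>(1)
      by (simp add: t_def kM.m_assoc monomial_closed monomial_mult)
    show ?case
    proof (cases "m \<in> Units M")
      case True
      show ?thesis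
      proof (rule G.monoid_algebra_eqI)
        fix u assume "u \<in> carrier (units_of M)"
        then have u: "u \<in> Units M" by (simp add: units_of_carrier)
        have mu: "inv\<^bsub>M\<^esub> m \<otimes>\<^bsub>M\<^esub> u \<in> Units M" using True u by simp
        \<comment> \<open>Since (m^{-1} u)^{-1} = u^{-1} m, translating b by m moves the coefficient
          at m^{-1} u to u.\<close>
        have inv: "inv\<^bsub>M\<^esub> (inv\<^bsub>M\<^esub> m \<otimes>\<^bsub>M\<^esub> u) = inv\<^bsub>M\<^esub> u \<otimes>\<^bsub>M\<^esub> m"
        proof -
          interpret UG: group "units_of M" by (rule group_units)
          have "inv\<^bsub>units_of M\<^esub> (inv\<^bsub>M\<^esub> m \<otimes>\<^bsub>units_of M\<^esub> u) =
              inv\<^bsub>units_of M\<^esub> u \<otimes>\<^bsub>units_of M\<^esub> inv\<^bsub>units_of M\<^esub> (inv\<^bsub>M\<^esub> m)"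
            using True u by (intro UG.inv_mult_group) (simp_all add: units_of_carrier)
          then show ?thesis using True u mu by (simp add: units_of_mult M.units_of_inv)
        qed
        \<comment> \<open>The scalar c is central, so it can be moved to the front, where \<mu>
          takes it out.\<close>
        have "t u \<otimes>\<^bsub>kM\<^esub> monomial k M m c = scalar_elem k M c \<otimes>\<^bsub>kM\<^esub> t (inv\<^bsub>M\<^esub> m \<otimes>\<^bsub>M\<^esub> u)"
          using u monomial \<eta>(1) unfolding tm[OF u]
          by (simp add: t_def inv scalar_elem_commute scalar_elem_closed monomial_closed kM.m_assoc)
            (simp add: scalar_elem_eq_monomial monomial_mult)
        then have "h (monomial k M m c \<odot>\<^bsub>B\<^esub> b) u = c \<otimes>\<^bsub>k\<^esub> h b (inv\<^bsub>M\<^esub> m \<otimes>\<^bsub>M\<^esub> u)"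
          using u mu monomial b t B.smult_assoc[of "t u" "monomial k M m c" b, symmetric]
          by (simp add: h_def \<mu>_smult B.smult_closed monomial_closed scalar_elem_closed
              B.smult_assoc)
        also have "\<dots> = (monomial k (units_of M) m c \<otimes>\<^bsub>kG\<^esub> h b) u"
          using True u monomial h_closed[OF b]
          by (simp add: G.coeff_monomial_unit_mult units_of_carrier units_of_mult M.units_of_inv)
        finally show "h (monomial k M m c \<odot>\<^bsub>B\<^esub> b) u =
            (unit_part M (monomial k M m c) \<otimes>\<^bsub>kG\<^esub> h b) u"
          using True by (simp add: unit_part_monomial)
      qed (use monomial b h_closed in \<open>auto simp: monomial_closed B.smult_closed unit_part_closed\<close>)
    next
      case False
      \<comment> \<open>Here u^{-1} m is a nonunit along with m, so \<eta> annihilates it; on the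
        other side the unit part of c m is zero.\<close>
      have "t u \<otimes>\<^bsub>kM\<^esub> monomial k M m c = \<zero>\<^bsub>kM\<^esub>" if u: "u \<in> Units M" for u
        using u False monomial M.finite_Units_mult_iff[OF finite_carrier, of "inv\<^bsub>M\<^esub> u" m]
        by (simp add: tm \<eta>(3))
      then have "\<mu> (t u \<odot>\<^bsub>B\<^esub> (monomial k M m c \<odot>\<^bsub>B\<^esub> b)) = \<zero>\<^bsub>k\<^esub>" if "u \<in> Units M" for u
        using that monomial b t
        by (simp add: monomial_closed B.smult_l_null \<mu>_zero flip: B.smult_assoc)
      then have "h (monomial k M m c \<odot>\<^bsub>B\<^esub> b) = \<zero>\<^bsub>kG\<^esub>"
        by (auto simp: h_def monoid_algebra_zero units_of_carrier fun_eq_iff)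
      then show ?thesis using False h_closed[OF b] by (simp add: unit_part_monomial)
    qed
  next
    case (add a c)
    then show ?case
      using b h_closed[OF b]
      by (simp add: B.smult_l_distr h_add B.smult_closed unit_part_add G.kM.l_distr
          unit_part_closed)
  qed
  have h_f: "h (f x) = g x" if x: "x \<in> carrier A" for x
  proof (rule G.monoid_algebra_eqI)
    fix u assume "u \<in> carrier (units_of M)"
    then have u: "u \<in> Units M" by (simp add: units_of_carrier)
    have "h (f x) u = \<mu> (f (t u \<odot>\<^bsub>A\<^esub> x))" using u x t by (simp add: h_def f_smult)
    also have "\<dots> = g (t u \<odot>\<^bsub>A\<^esub> x) \<one>\<^bsub>M\<^esub>"
      using x t by (simp add: \<mu>l l_def fi A.smult_closed)
    \<comment> \<open>The unit part of \<eta> is 1, so \<open>t u\<close> acts on g(x) as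
      u^{-1}.\<close>
    also have "\<dots> = (monomial k (units_of M) (inv\<^bsub>M\<^esub> u) \<one>\<^bsub>k\<^esub> \<otimes>\<^bsub>kG\<^esub> g x) \<one>\<^bsub>M\<^esub>"
      using u x \<eta> g_closed(1)[OF x]
      by (simp add: g_smult t) (simp add: t_def unit_part_mult monomial_closed unit_part_monomial
          G.monomial_closed)
    also have "\<dots> = g x u"
      using u one g_closed(1)[OF x] G.coeff_closed[OF g_closed(1)[OF x], of u]
      by (simp add: G.coeff_monomial_unit_mult units_of_carrier units_of_mult M.units_of_inv
          M.Units_closed)
    finally show "h (f x) u = g x u" .
  qed (use x f_closed h_closed g_closed in auto)
  show ?thesis
  proof (intro bexI ballI)
    \<comment> \<open>Right multiplication by e is left kG-linear, projects kG onto kG e and fixes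
      every g(x).\<close>
    show "(\<lambda>b. h b \<otimes>\<^bsub>kG\<^esub> e) \<in> left_module_hom kM B (ind_module M (left_ideal_module kG e))"
      using e
      by (auto simp: left_module_hom_def ind_module_smult h_closed h_add h_smult G.kM.m_assoc
          G.kM.l_distr unit_part_closed)
    fix x assume "x \<in> carrier A"
    then show "h (f x) \<otimes>\<^bsub>kG\<^esub> e = g x" using h_f g_closed by simp
  qed
qed

section \<open>A copy of kG e as the required module\<close>

lemma ind_module_hom:
  assumes "\<phi> \<in> left_module_hom kG V W"
  shows "\<phi> \<in> left_module_hom kM (ind_module M V) (ind_module M W)"
  using assms by (auto simp: left_module_hom_def ind_module_smult unit_part_closed)

text \<open>The left ideal kG e is replaced by its isomorphic copy P, whose carrier has the type
  that \<open>group_injective\<close> asks for. Lifting and extension problems for P are moved to kG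
  e along \<phi> and its inverse and solved there.\<close>

lemma group_injective_finite_inverse_monoid: "group_injective k M"
proof -
  obtain e where e: "e \<in> carrier kG" "e \<otimes>\<^bsub>kG\<^esub> e = e"
    and ind: "indecomposable_module kG (left_ideal_module kG e)"
    by (rule G.ex_indecomposable_left_ideal_module)
  let ?E = "left_ideal_module kG e"
  have E: "left_module kG ?E" by (rule G.kM.left_module_left_ideal[OF e(1)])
  obtain P :: "('m \<Rightarrow> 'k, nat \<Rightarrow> 'k) module" and \<phi> where P: "fd_module k (units_of M) P"
    and \<phi>: "\<phi> \<in> left_module_hom kG ?E P" "bij_betw \<phi> (carrier ?E) (carrier P)"
    and \<psi>: "inv_into (carrier ?E) \<phi> \<in> left_module_hom kG P ?E"
    by (rule fd_module_copy[OF k.ring_axioms G.fd_left_ideal_module[OF e]])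
  let ?\<psi> = "inv_into (carrier ?E) \<phi>"
  have \<phi>\<psi>: "\<phi> (?\<psi> x) = x" and \<psi>_closed: "?\<psi> x \<in> carrier ?E" if "x \<in> carrier P" for x
    using \<phi>(2) that by (simp_all only: bij_betw_def f_inv_into_f inv_into_into)
  have \<psi>\<phi>: "?\<psi> (\<phi> x) = x" if "x \<in> carrier ?E" for x
    using \<phi>(2) that by (simp only: bij_betw_def inv_into_f_f)
  have LP: "left_module kG P" using P by (simp add: fd_module_def)
  have "projective_module k (units_of M) P"
    unfolding projective_module_def
  proof (intro conjI allI impI ballI P)
    fix A B :: "('m \<Rightarrow> 'k, nat \<Rightarrow> 'k) module" and f g
    assume "fd_module k (units_of M) A \<and> fd_module k (units_of M) B"
    then have A: "left_module kG A" by (simp add: fd_module_def)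
    assume f: "f \<in> left_module_hom kG A B" "f ` carrier A = carrier B"
      and g: "g \<in> left_module_hom kG P B"
    obtain h where h: "h \<in> left_module_hom kG ?E A" "\<forall>x\<in>carrier ?E. f (h x) = g (\<phi> x)"
      using G.left_ideal_module_lift[OF e A f left_module_hom_comp[OF \<phi>(1) g]] by blast
    show "\<exists>h\<in>left_module_hom kG P A. \<forall>x\<in>carrier P. f (h x) = g x"
    proof (intro bexI ballI)
      show "(\<lambda>x. h (?\<psi> x)) \<in> left_module_hom kG P A" by (rule left_module_hom_comp[OF \<psi> h(1)])
      fix x assume "x \<in> carrier P"
      then show "f (h (?\<psi> x)) = g x" using h(2) \<phi>\<psi> \<psi>_closed by metis
    qed
  qed
  moreover have "indecomposable_module kG P"
    by (rule indecomposable_module_iso[OF E LP \<phi> ind])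
  moreover have "injective_module k M (ind_module M P)"
    unfolding injective_module_def
  proof (intro conjI allI impI ballI fd_ind_module P)
    fix A B :: "('m \<Rightarrow> 'k, nat \<Rightarrow> 'k) module" and f g
    assume AB: "fd_module k M A \<and> fd_module k M B"
    then have A: "left_module kM A" and B: "fd_module k M B" by (simp_all add: fd_module_def)
    assume f: "f \<in> left_module_hom kM A B" "inj_on f (carrier A)"
      and g: "g \<in> left_module_hom kM A (ind_module M P)"
    obtain h where h: "h \<in> left_module_hom kM B (ind_module M ?E)"
      "\<forall>x\<in>carrier A. h (f x) = ?\<psi> (g x)"
      using ind_left_ideal_module_extend[OF e A B f
          left_module_hom_comp[OF g ind_module_hom[OF \<psi>]]] by blast
    show "\<exists>h\<in>left_module_hom kM B (ind_module M P). \<forall>x\<in>carrier A. h (f x) = g x"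
    proof (intro bexI ballI)
      show "(\<lambda>x. \<phi> (h x)) \<in> left_module_hom kM B (ind_module M P)"
        by (rule left_module_hom_comp[OF h(1) ind_module_hom[OF \<phi>(1)]])
      fix x assume x: "x \<in> carrier A"
      then have "g x \<in> carrier P" using g by (auto simp: left_module_hom_def)
      with x show "\<phi> (h (f x)) = g x" using h(2) \<phi>\<psi> by simp
    qed
  qed
  ultimately show ?thesis unfolding group_injective_def by blast
qed

end

theorem proposition3p2p1:
  fixes k :: "('k, 'c) ring_scheme" and M :: "('m, 'd) monoid_scheme"
  assumes "algebraically_closed k"
    and "inverse_monoid M" and "finite (carrier M)"
  shows "group_injective k M"
proof -
  interpret k: algebraically_closed k by fact
  interpret M: inverse_monoid M by fact
  interpret finite_inverse_monoid_algebra k M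
    by unfold_locales fact
  show ?thesis by (rule group_injective_finite_inverse_monoid)
qed

end
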